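(* Equip $\mathbb R$ with Lebesgue measure $\lambda$. Let $1\le q<p\le\infty$, $\alpha=1/q-1/p$, $C(p,q)=(1-q/p)^{1/q}$, and consider the couple $A_0=L^{p,\infty}(dx;L^q(dy))$, $A_1=L^{p,\infty}(dy;L^q(dx))$ of functions $a(x,y)$ on $\mathbb R^2$, with quasi-norms $\|a\|_{A_0}=\big\|x\mapsto\|a(x,\cdot)\|_{L^q}\big\|_{L^{p,\infty}}$ and $\|a\|_{A_1}=\big\|y\mapsto\|a(\cdot,y)\|_{L^q}\big\|_{L^{p,\infty}}$. For $t>0$ let $K_{p,q,t}(a)=\inf\{\|b\|_{A_0}+t\|c\|_{A_1}: a=b+c\}$ and $$|||a|||_{p,q,t}=\sup_{E,F}\big(\lambda(E)^{\alpha}\vee t^{-1}\lambda(F)^{\alpha}\big)^{-1}\Big(\iint_{E\times F}|a(x,y)|^q\,dx\,dy\Big)^{1/q},$$ the supremum over measurable $E,F\subset\mathbb R$ of positive finite measure. Then for any $t>0$ and every $a\in A_0+A_1$, $$C(p,q)\,|||a|||_{p,q,t}\le K_{p,q,t}(a)\le 2\,|||a|||_{p,q,t}.$$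
   Context: Vector-valued spaces are in Bochner's sense. For a nonnegative measurable $g$, $g^*(s)=\inf\{\mu>0:\lambda\{g>\mu\}\le s\}$ and $\|g\|_{L^{p,\infty}}=\sup_{s>0}s^{1/p}g^*(s)$ (the sup norm when $p=\infty$). $u\vee v=\max(u,v)$. *)

theory Defs
  imports "HOL-Analysis.Analysis"
begin

text \<open>Power x^r of an extended nonnegative real, for an exponent r > 0
  (with infinity to the power r equal to infinity).\<close>
definition enn_powr :: "ennreal \<Rightarrow> real \<Rightarrow> ennreal" where
  "enn_powr x r = (if x = \<infinity> then \<infinity> else ennreal (enn2real x powr r))"

text \<open>1/p for p in [1, infinity], with 1/infinity = 0.\<close>
definition pinv :: "ereal \<Rightarrow> real" where
  "pinv p = real_of_ereal (inverse p)"

definition drearr :: "(real \<Rightarrow> ennreal) \<Rightarrow> real \<Rightarrow> ennreal" where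
  "drearr g s = Inf {ennreal \<mu> | \<mu>. \<mu> > 0 \<and> emeasure lborel {x. g x > ennreal \<mu>} \<le> ennreal s}"

text \<open>Weak-L^p quasi-norm sup_{s>0} s^{1/p} g*(s); for p = infinity the factor is s^0 = 1,
  giving the (essential) sup norm.\<close>
definition weakLp_norm :: "ereal \<Rightarrow> (real \<Rightarrow> ennreal) \<Rightarrow> ennreal" where
  "weakLp_norm p g = (SUP s\<in>{0<..}. ennreal (s powr pinv p) * drearr g s)"

definition slice_norm_x :: "real \<Rightarrow> (real \<times> real \<Rightarrow> real) \<Rightarrow> real \<Rightarrow> ennreal" where
  "slice_norm_x q a x = enn_powr (\<integral>\<^sup>+ y. ennreal (\<bar>a (x, y)\<bar> powr q) \<partial>lborel) (1 / q)"

definition slice_norm_y :: "real \<Rightarrow> (real \<times> real \<Rightarrow> real) \<Rightarrow> real \<Rightarrow> ennreal" where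
  "slice_norm_y q a y = enn_powr (\<integral>\<^sup>+ x. ennreal (\<bar>a (x, y)\<bar> powr q) \<partial>lborel) (1 / q)"

definition normA0 :: "ereal \<Rightarrow> real \<Rightarrow> (real \<times> real \<Rightarrow> real) \<Rightarrow> ennreal" where
  "normA0 p q a = weakLp_norm p (slice_norm_x q a)"

definition normA1 :: "ereal \<Rightarrow> real \<Rightarrow> (real \<times> real \<Rightarrow> real) \<Rightarrow> ennreal" where
  "normA1 p q a = weakLp_norm p (slice_norm_y q a)"

text \<open>A_0 = L^{p,\<infinity>}(dx; L^q(dy)) and A_1 = L^{p,\<infinity>}(dy; L^q(dx)), realized by
  jointly measurable representatives on R^2.\<close>
definition spaceA0 :: "ereal \<Rightarrow> real \<Rightarrow> (real \<times> real \<Rightarrow> real) set" where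
  "spaceA0 p q = {a. a \<in> borel_measurable (lborel \<Otimes>\<^sub>M lborel) \<and> normA0 p q a < \<infinity>}"

definition spaceA1 :: "ereal \<Rightarrow> real \<Rightarrow> (real \<times> real \<Rightarrow> real) set" where
  "spaceA1 p q = {a. a \<in> borel_measurable (lborel \<Otimes>\<^sub>M lborel) \<and> normA1 p q a < \<infinity>}"

definition sumA :: "ereal \<Rightarrow> real \<Rightarrow> (real \<times> real \<Rightarrow> real) set" where
  "sumA p q = {a. \<exists>b c. b \<in> spaceA0 p q \<and> c \<in> spaceA1 p q \<and> a = (\<lambda>z. b z + c z)}"

definition Kfun :: "ereal \<Rightarrow> real \<Rightarrow> real \<Rightarrow> (real \<times> real \<Rightarrow> real) \<Rightarrow> ennreal" where
  "Kfun p q t a = Inf {normA0 p q b + ennreal t * normA1 p q c | b c.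
      b \<in> spaceA0 p q \<and> c \<in> spaceA1 p q \<and> a = (\<lambda>z. b z + c z)}"

definition triple_norm :: "ereal \<Rightarrow> real \<Rightarrow> real \<Rightarrow> (real \<times> real \<Rightarrow> real) \<Rightarrow> ennreal" where
  "triple_norm p q t a =
     (SUP EF\<in>{(E, F). E \<in> sets lborel \<and> F \<in> sets lborel \<and>
                 0 < emeasure lborel E \<and> emeasure lborel E < \<infinity> \<and>
                 0 < emeasure lborel F \<and> emeasure lborel F < \<infinity>}.
        ennreal (1 / max (measure lborel (fst EF) powr (1 / q - pinv p))
                         ((1 / t) * measure lborel (snd EF) powr (1 / q - pinv p)))
        * enn_powr (\<integral>\<^sup>+ z. ennreal (\<bar>a z\<bar> powr q) * indicator (fst EF \<times> snd EF) z
                      \<partial>(lborel \<Otimes>\<^sub>M lborel)) (1 / q))"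

end

theory Submission
  imports Defs
begin

text \<open>
  Put f = |a|^q and \<beta> = 1 - q/p. The lower bound is Minkowski's inequality on E \<times> F together with the
  bound N^q |E|^\<beta> / \<beta> for the integral over E of the q-th power of a function of weak L^p quasi-norm N.

  For the upper bound, fix a level s and, inside a square, repeatedly delete the rows whose f-mass over
  the surviving columns is at most c = A s^(\<beta>-1), and the columns whose f-mass over the surviving
  rows is at most a corresponding d. What survives for ever is a pair of sets (C, D) with
  c |C| \<le> f(C \<times> D) and d |D| \<le> f(C \<times> D), so the bound on rectangles given by the triple norm forces
  |C| \<le> s, and likewise for D. Giving each point of the square to its row or to its column,
  according to which is deleted first, bounds the mass of every row outside C by c and of every
  column outside D by d; doing this successively for finitely many levels s in a geometric
  progression controls the weak quasi-norms, up to the ratio of the progression.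

  For increasing squares the cores C, D increase, so their unions still have measure at most s. The
  [0,1]-valued functions \<theta> on the plane for which \<theta> f and (1 - \<theta>) f obey these row and column bounds on
  the n-th square form a decreasing sequence of nonempty convex sets. Near-minimisers of a weighted
  L^2 norm on these sets are Cauchy, and an almost everywhere limit \<theta> obeys all the bounds by Fatou.
  Then a = \<theta> a + (1 - \<theta>) a is the required decomposition, because \<theta>^q \<le> \<theta>.
\<close>

abbreviation plane :: "(real \<times> real) measure" where
  "plane \<equiv> lborel \<Otimes>\<^sub>M lborel"

section \<open>The lower bound\<close>

text \<open>Fubini for the region under the graph of \<open>r\<close> over \<open>E\<close>: the
  vertical slice at \<open>x\<close> is the interval from 0 to \<open>r x\<close>, the horizontal
  slice at height \<tau> is the part of \<open>E\<close> where \<open>r\<close> exceeds \<tau>.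
  Infinite values of \<open>r\<close> are included.\<close>

lemma layer_cake:
  fixes r :: "real \<Rightarrow> ennreal"
  assumes [measurable]: "r \<in> borel_measurable lborel" "E \<in> sets lborel"
  shows "(\<integral>\<^sup>+ x. r x * indicator E x \<partial>lborel) =
    (\<integral>\<^sup>+ \<tau>. emeasure lborel (E \<inter> {x. ennreal \<tau> < r x}) * indicator {0..} \<tau> \<partial>lborel)"
proof -
  let ?P = "\<lambda>x \<tau>. x \<in> E \<and> 0 \<le> \<tau> \<and> ennreal \<tau> < r x"
  have slice: "r x * indicator E x = (\<integral>\<^sup>+ \<tau>. indicator {\<tau>. ?P x \<tau>} \<tau> \<partial>lborel)" for x
  proof (cases "x \<in> E")
    case True
    have "(\<integral>\<^sup>+ \<tau>. indicator {\<tau>. ?P x \<tau>} \<tau> \<partial>lborel) = emeasure lborel {\<tau>. ?P x \<tau>}"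
      by (subst nn_integral_indicator) auto
    also have "\<dots> = r x"
    proof (cases "r x")
      case (real R)
      then have "{\<tau>. ?P x \<tau>} = {0..<R}" using True by (auto simp: ennreal_less_iff)
      then show ?thesis using real by simp
    next
      case top
      then have "{\<tau>. ?P x \<tau>} = {0..}" using True by auto
      \<comment> \<open>An infinite value of \<open>r\<close> gives the whole half-line as slice;
        were its length a finite \<open>R\<close>, it could not contain an interval of length
        \<open>R + 1\<close>.\<close>
      moreover have "emeasure lborel {0::real..} = top"
      proof (rule ccontr)
        assume "emeasure lborel {0::real..} \<noteq> top"
        then obtain R where R: "emeasure lborel {0::real..} = ennreal R" "0 \<le> R"
          by (cases "emeasure lborel {0::real..}") auto
        have "emeasure lborel {0..R + 1} \<le> emeasure lborel {0::real..}"
          by (intro emeasure_mono) auto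
        then show False using R by (simp del: ennreal_plus)
      qed
      ultimately show ?thesis using top by simp
    qed
    finally show ?thesis using True by simp
  qed simp
  have "(\<integral>\<^sup>+ x. r x * indicator E x \<partial>lborel)
      = (\<integral>\<^sup>+ x. \<integral>\<^sup>+ \<tau>. indicator {\<tau>. ?P x \<tau>} \<tau> \<partial>lborel \<partial>lborel)"
    by (simp add: slice)
  also have "\<dots> = (\<integral>\<^sup>+ \<tau>. \<integral>\<^sup>+ x. indicator {\<tau>. ?P x \<tau>} \<tau> \<partial>lborel \<partial>lborel)"
    by (rule lborel_pair.Fubini'[symmetric]) measurable
  also have "\<dots> = (\<integral>\<^sup>+ \<tau>. emeasure lborel (E \<inter> {x. ennreal \<tau> < r x}) * indicator {0..} \<tau> \<partial>lborel)"
  proof (intro nn_integral_cong)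
    fix \<tau> :: real
    have [measurable]: "E \<inter> {x. ennreal \<tau> < r x} \<in> sets lborel"
    proof -
      have "E \<inter> {x \<in> space lborel. ennreal \<tau> < r x} \<in> sets lborel" by measurable
      then show ?thesis by simp
    qed
    have "(\<integral>\<^sup>+ x. indicator {\<tau>. ?P x \<tau>} \<tau> \<partial>lborel)
        = (\<integral>\<^sup>+ x. indicator {0..} \<tau> * indicator (E \<inter> {x. ennreal \<tau> < r x}) x \<partial>lborel)"
      by (intro nn_integral_cong) (auto split: split_indicator)
    also have "\<dots> = indicator {0..} \<tau> * emeasure lborel (E \<inter> {x. ennreal \<tau> < r x})"
      by (rule nn_integral_cmult_indicator) measurable
    finally show "(\<integral>\<^sup>+ x. indicator {\<tau>. ?P x \<tau>} \<tau> \<partial>lborel)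
        = emeasure lborel (E \<inter> {x. ennreal \<tau> < r x}) * indicator {0..} \<tau>" by (simp add: mult.commute)
  qed
  finally show ?thesis .
qed

text \<open>The norm bound gives g*(s) \<le> N s^(-1/p). The infimum defining g* is then turned into
  a bound at the level itself by continuity of the measure from below.\<close>

lemma weakLp_norm_level:
  fixes g :: "real \<Rightarrow> ennreal"
  assumes [measurable]: "g \<in> borel_measurable lborel"
    and N: "weakLp_norm p g \<le> ennreal N" "0 \<le> N" and s: "s > 0"
  shows "emeasure lborel {x. ennreal (N * s powr - pinv p) < g x} \<le> ennreal s"
proof -
  define v where "v = N * s powr - pinv p"
  have v0: "0 \<le> v" using N by (simp add: v_def)
  have "ennreal (s powr pinv p) * drearr g s \<le> weakLp_norm p g"
    unfolding weakLp_norm_def using s by (intro SUP_upper) auto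
  with N have "ennreal (s powr pinv p) * drearr g s \<le> ennreal N" by simp
  then have "ennreal (s powr - pinv p) * (ennreal (s powr pinv p) * drearr g s)
      \<le> ennreal (s powr - pinv p) * ennreal N" by (intro mult_left_mono) auto
  moreover have one: "ennreal (s powr - pinv p) * ennreal (s powr pinv p) = 1"
    using s by (simp add: ennreal_mult[symmetric] powr_add[symmetric])
  moreover have "ennreal (s powr - pinv p) * ennreal N = ennreal v"
    using N by (simp add: v_def ennreal_mult[symmetric] mult.commute)
  ultimately have dr: "drearr g s \<le> ennreal v"
    unfolding mult.assoc[symmetric] by simp
  have sets: "{x. u < g x} \<in> sets lborel" for u
  proof -
    have "{x \<in> space lborel. u < g x} \<in> sets lborel" by measurable
    then show ?thesis by simp
  qed
  \<comment> \<open>Levels strictly above \<open>v\<close> are needed first: the infimum only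
    supplies some \<mu> below \<open>v + 1 / Suc k\<close>. The sets \<open>S k\<close> increase to
    the superlevel set of \<open>v\<close>.\<close>
  define S where "S k = {x. ennreal (v + 1 / Suc k) < g x}" for k
  have S_le: "emeasure lborel (S k) \<le> ennreal s" for k
  proof -
    have "drearr g s < ennreal (v + 1 / Suc k)"
      using dr v0 by (elim order.strict_trans1) (simp add: ennreal_less_iff)
    then obtain \<mu> where \<mu>: "\<mu> > 0" "emeasure lborel {x. g x > ennreal \<mu>} \<le> ennreal s"
      "ennreal \<mu> < ennreal (v + 1 / Suc k)"
      unfolding drearr_def Inf_less_iff by auto
    have "emeasure lborel (S k) \<le> emeasure lborel {x. g x > ennreal \<mu>}"
      using \<mu>(3) sets by (intro emeasure_mono) (auto simp: S_def)
    with \<mu>(2) show ?thesis by simp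
  qed
  have "(SUP k. emeasure lborel (S k)) = emeasure lborel (\<Union>k. S k)"
  proof (intro SUP_emeasure_incseq incseq_SucI)
    show "range S \<subseteq> sets lborel" using sets by (auto simp: S_def)
    fix k
    have "ennreal (v + 1 / Suc (Suc k)) \<le> ennreal (v + 1 / Suc k)"
      by (intro ennreal_leI add_left_mono divide_left_mono) auto
    then show "S k \<subseteq> S (Suc k)" by (auto simp: S_def)
  qed
  also have "(\<Union>k. S k) = {x. ennreal v < g x}"
  proof (intro set_eqI iffI)
    fix x assume "x \<in> (\<Union>k. S k)"
    then obtain k where "ennreal (v + 1 / Suc k) < g x" by (auto simp: S_def)
    moreover have "ennreal v \<le> ennreal (v + 1 / Suc k)" by (intro ennreal_leI) auto
    ultimately show "x \<in> {x. ennreal v < g x}" by auto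
  next
    fix x assume "x \<in> {x. ennreal v < g x}"
    then have "ennreal v < g x" by simp
    then obtain w where w: "ennreal v < w" "w < g x" using dense by blast
    then obtain w' where w': "w = ennreal w'" "0 \<le> w'" by (cases w) auto
    with w v0 have "v < w'" by (simp add: ennreal_less_iff)
    then obtain k where "1 / Suc k < w' - v" using nat_approx_posE[of "w' - v"] by auto
    then have "ennreal (v + 1 / Suc k) \<le> w" unfolding w' by (intro ennreal_leI) auto
    then have "x \<in> S k" unfolding S_def mem_Collect_eq using w(2) by (rule order.strict_trans1)
    then show "x \<in> (\<Union>k. S k)" by blast
  qed
  finally show ?thesis using SUP_least[of UNIV "\<lambda>k. emeasure lborel (S k)"] S_le by (simp add: v_def)
qed

text \<open>The hypothesis \<open>level\<close> says that the decreasing rearrangement of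
  \<open>r\<close> is at most A s^(\<beta>-1), so the integral over a set of measure m is at most
  the integral of this power over (0, m). The proof compares the distribution functions of
  \<open>r\<close> on \<open>E\<close> and of the power on (0, m), and applies the layer cake
  formula in both directions.\<close>

lemma weak_type_integral_le:
  fixes r :: "real \<Rightarrow> ennreal"
  assumes [measurable]: "r \<in> borel_measurable lborel" "E \<in> sets lborel"
    and \<beta>: "0 < \<beta>" "\<beta> \<le> 1" and A: "0 \<le> A" and fin: "emeasure lborel E < \<infinity>"
    and level: "\<And>s. s > 0 \<Longrightarrow> emeasure lborel {x. ennreal (A * s powr (\<beta> - 1)) < r x} \<le> ennreal s"
  shows "(\<integral>\<^sup>+ x. r x * indicator E x \<partial>lborel) \<le> ennreal (A * measure lborel E powr \<beta> / \<beta>)"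
proof -
  define m where "m = measure lborel E"
  have em: "emeasure lborel E = ennreal m"
    using fin by (simp add: m_def emeasure_eq_ennreal_measure)
  have m0: "0 \<le> m" by (simp add: m_def)
  let ?\<phi> = "\<lambda>s. A * s powr (\<beta> - 1)"
  have sets: "{x. u < r x} \<in> sets lborel" for u
  proof -
    have "{x \<in> space lborel. u < r x} \<in> sets lborel" by measurable
    then show ?thesis by simp
  qed
  have cmp: "emeasure lborel (E \<inter> {x. ennreal \<tau> < r x})
      \<le> emeasure lborel ({0<..<m} \<inter> {s. ennreal \<tau> < ennreal (?\<phi> s)})" if \<tau>: "0 \<le> \<tau>" for \<tau>
  proof -
    define S where "S = {0<..<m} \<inter> {s. ennreal \<tau> < ennreal (?\<phi> s)}"
    have S_sets[measurable]: "S \<in> sets lborel"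
    proof -
      have "{0<..<m} \<inter> {s \<in> space lborel. ennreal \<tau> < ennreal (?\<phi> s)} \<in> sets lborel" by measurable
      then show ?thesis by (simp add: S_def)
    qed
    have "emeasure lborel S \<le> emeasure lborel {0<..<m}"
      by (intro emeasure_mono) (auto simp: S_def)
    then have "emeasure lborel S \<le> ennreal m" using m0 by simp
    then obtain \<sigma> where \<sigma>: "emeasure lborel S = ennreal \<sigma>" "0 \<le> \<sigma>"
      by (cases "emeasure lborel S") (auto simp: top_unique)
    show ?thesis
    proof (cases "\<sigma> < m")
      case False
      have "emeasure lborel (E \<inter> {x. ennreal \<tau> < r x}) \<le> emeasure lborel E"
        using assms(2) by (intro emeasure_mono) auto
      also have "\<dots> \<le> ennreal \<sigma>" using False em by (simp add: ennreal_leI)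
      finally show ?thesis using \<sigma> by (simp add: S_def)
    next
      case True
      \<comment> \<open>As the power is nonincreasing, \<open>S\<close> contains (0, s] as soon as
        the power exceeds \<tau> at s. For s beyond the length \<sigma> of \<open>S\<close> this is
        impossible, so the level bound at s applies; afterwards s tends to \<sigma>.\<close>
      have le: "emeasure lborel (E \<inter> {x. ennreal \<tau> < r x}) \<le> ennreal s" if s: "\<sigma> < s" "s < m" for s
      proof -
        have s0: "0 < s" using s \<sigma> by simp
        have "?\<phi> s \<le> \<tau>"
        proof (rule ccontr)
          assume "\<not> ?\<phi> s \<le> \<tau>"
          then have gt: "\<tau> < ?\<phi> s" by simp
          have "{0<..s} \<subseteq> S"
          proof
            fix s' assume s': "s' \<in> {0<..s}"
            have "?\<phi> s \<le> ?\<phi> s'" using s' A \<beta> by (intro mult_left_mono powr_mono2') auto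
            with gt have "\<tau> < ?\<phi> s'" by simp
            then show "s' \<in> S" using s' s \<tau> by (auto simp: S_def ennreal_less_iff)
          qed
          then have "emeasure lborel {0<..s} \<le> emeasure lborel S"
            using S_sets by (intro emeasure_mono) auto
          then have "ennreal s \<le> ennreal \<sigma>" using s0 \<sigma> by simp
          then show False using s \<sigma> by simp
        qed
        then have "ennreal (?\<phi> s) \<le> ennreal \<tau>" by (rule ennreal_leI)
        then have "emeasure lborel (E \<inter> {x. ennreal \<tau> < r x}) \<le> emeasure lborel {x. ennreal (?\<phi> s) < r x}"
          using sets by (intro emeasure_mono) auto
        also have "\<dots> \<le> ennreal s" by (rule level[OF s0])
        finally show ?thesis .
      qed
      have "emeasure lborel (E \<inter> {x. ennreal \<tau> < r x}) \<le> ennreal \<sigma> + ennreal e" if e: "e > 0" for e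
      proof -
        have "emeasure lborel (E \<inter> {x. ennreal \<tau> < r x}) \<le> ennreal (\<sigma> + min e ((m - \<sigma>) / 2))"
          using True e by (intro le) (auto simp: min_def field_simps)
        also have "\<dots> \<le> ennreal (\<sigma> + e)" by (intro ennreal_leI) auto
        finally show ?thesis using \<sigma> e by simp
      qed
      then have "emeasure lborel (E \<inter> {x. ennreal \<tau> < r x}) \<le> ennreal \<sigma>"
        by (rule ennreal_le_epsilon)
      then show ?thesis using \<sigma> by (simp add: S_def)
    qed
  qed
  have "(\<integral>\<^sup>+ x. r x * indicator E x \<partial>lborel)
      = (\<integral>\<^sup>+ \<tau>. emeasure lborel (E \<inter> {x. ennreal \<tau> < r x}) * indicator {0..} \<tau> \<partial>lborel)"
    by (rule layer_cake) measurable
  also have "\<dots> \<le> (\<integral>\<^sup>+ \<tau>. emeasure lborel ({0<..<m} \<inter> {s. ennreal \<tau> < ennreal (?\<phi> s)}) * indicator {0..} \<tau> \<partial>lborel)"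
    using cmp by (intro nn_integral_mono) (auto split: split_indicator)
  also have "\<dots> = (\<integral>\<^sup>+ s. ennreal (?\<phi> s) * indicator {0<..<m} s \<partial>lborel)"
    by (rule layer_cake[symmetric]) measurable
  \<comment> \<open>The closed interval fits the known integral of a power on [0, m]; \<beta> > 0
    makes the singularity at 0 integrable.\<close>
  also have "\<dots> \<le> (\<integral>\<^sup>+ s. ennreal (if s \<in> {0..m} then ?\<phi> s else 0) \<partial>lborel)"
    by (intro nn_integral_mono) (auto split: split_indicator)
  also have "\<dots> = ennreal (A * (m powr (\<beta> - 1 + 1) / (\<beta> - 1 + 1)))"
  proof (rule nn_integral_has_integral_lborel)
    show "(\<lambda>s. if s \<in> {0..m} then ?\<phi> s else 0) \<in> borel_measurable borel" by measurable
    have "(?\<phi> has_integral A * (m powr (\<beta> - 1 + 1) / (\<beta> - 1 + 1))) {0..m}"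
      using \<beta> m0 by (intro has_integral_mult_right has_integral_powr_from_0) auto
    then show "((\<lambda>s. if s \<in> {0..m} then ?\<phi> s else 0)
        has_integral A * (m powr (\<beta> - 1 + 1) / (\<beta> - 1 + 1))) UNIV"
      by (simp only: has_integral_restrict_UNIV)
  qed (use A in auto)
  finally show ?thesis by (simp add: m_def)
qed

text \<open>Convexity of the q-th power at the points u/A and v/B with weights A/(A+B) and B/(A+B).
  The weights are such that u^q and v^q of integral A^q and B^q produce exactly (A+B)^q on the right
  after integration.\<close>

lemma powr_add_le_weighted:
  fixes u v A B q :: real
  assumes "0 \<le> u" "0 \<le> v" "0 < A" "0 < B" "1 \<le> q"
  shows "(u + v) powr q \<le> (A + B) powr (q - 1) * (A powr (1 - q) * u powr q + B powr (1 - q) * v powr q)"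
proof -
  \<comment> \<open>This settles the cases where u or v vanishes; convexity is applied to positive
    numbers.\<close>
  have one: "1 \<le> (A + B) powr (q - 1) * C powr (1 - q)" if "0 < C" "C \<le> A + B" for C
  proof -
    have "(A + B) powr (q - 1) * C powr (1 - q) = ((A + B) / C) powr (q - 1)"
      using that assms powr_minus_divide[of C "q - 1"] by (simp add: powr_divide)
    also have "1 \<le> \<dots>" using that assms by (intro ge_one_powr_ge_zero) auto
    finally show ?thesis .
  qed
  consider "u = 0" | "v = 0" | "0 < u" "0 < v" using assms by linarith
  then show ?thesis
  proof cases
    case 1
    have "1 * v powr q \<le> (A + B) powr (q - 1) * B powr (1 - q) * v powr q"
      using one[of B] assms by (intro mult_right_mono) auto
    then show ?thesis using 1 assms by (simp add: algebra_simps)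
  next
    case 2
    have "1 * u powr q \<le> (A + B) powr (q - 1) * A powr (1 - q) * u powr q"
      using one[of A] assms by (intro mult_right_mono) auto
    then show ?thesis using 2 assms by (simp add: algebra_simps)
  next
    case 3
    let ?S = "A + B"
    have S: "0 < ?S" using assms by simp
    have t: "1 - B / ?S = A / ?S" using S by (simp add: field_simps)
    have "((A / ?S) * (u / A) + (B / ?S) * (v / B)) powr q
        \<le> (A / ?S) * (u / A) powr q + (B / ?S) * (v / B) powr q"
      using convex_onD[OF powr_convex[OF assms(5)], of "B / ?S" "u / A" "v / B"] 3 assms
      unfolding t by simp
    also have "(A / ?S) * (u / A) + (B / ?S) * (v / B) = (u + v) / ?S"
      using assms by (simp add: add_divide_distrib)
    finally have "(u + v) powr q / ?S powr q \<le> (A / ?S) * (u / A) powr q + (B / ?S) * (v / B) powr q"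
      using 3 S by (simp add: powr_divide)
    then have "(u + v) powr q \<le> ?S powr q * ((A / ?S) * (u / A) powr q + (B / ?S) * (v / B) powr q)"
      using S by (simp add: field_simps)
    also have "\<dots> = ?S powr (q - 1) * (A powr (1 - q) * u powr q + B powr (1 - q) * v powr q)"
    proof -
      have "A * (u / A) powr q = A powr (1 - q) * u powr q" "B * (v / B) powr q = B powr (1 - q) * v powr q"
        using 3 assms by (simp_all add: powr_divide powr_diff)
      moreover have "?S powr (q - 1) = ?S powr q / ?S" using S by (simp add: powr_diff)
      moreover have "?S powr q * (A / ?S * X + B / ?S * Y) = ?S powr q / ?S * (A * X + B * Y)" for X Y
        by (simp add: distrib_left)
      ultimately show ?thesis by (simp only:)
    qed
    finally show ?thesis .
  qed
qed

text \<open>Minkowski's inequality in terms of upper bounds \<open>A\<close>, \<open>B\<close> for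
  the norms, obtained by integrating the weighted pointwise inequality. Positivity of the bounds is
  why small errors are added to the norms where it is applied.\<close>

lemma Minkowski_set_nn_integral:
  fixes b c :: "'a \<Rightarrow> real"
  assumes [measurable]: "b \<in> borel_measurable M" "c \<in> borel_measurable M" "S \<in> sets M"
    and AB: "0 < A" "0 < B" and q: "1 \<le> q"
    and b: "(\<integral>\<^sup>+ z. ennreal (\<bar>b z\<bar> powr q) * indicator S z \<partial>M) \<le> ennreal (A powr q)"
    and c: "(\<integral>\<^sup>+ z. ennreal (\<bar>c z\<bar> powr q) * indicator S z \<partial>M) \<le> ennreal (B powr q)"
  shows "(\<integral>\<^sup>+ z. ennreal (\<bar>b z + c z\<bar> powr q) * indicator S z \<partial>M) \<le> ennreal ((A + B) powr q)"
proof -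
  let ?k = "(A + B) powr (q - 1)"
  let ?ka = "?k * A powr (1 - q)" and ?kb = "?k * B powr (1 - q)"
  have "(\<integral>\<^sup>+ z. ennreal (\<bar>b z + c z\<bar> powr q) * indicator S z \<partial>M)
     \<le> (\<integral>\<^sup>+ z. ennreal ?ka * (ennreal (\<bar>b z\<bar> powr q) * indicator S z)
           + ennreal ?kb * (ennreal (\<bar>c z\<bar> powr q) * indicator S z) \<partial>M)"
  proof (intro nn_integral_mono)
    fix z
    have "\<bar>b z + c z\<bar> powr q \<le> (\<bar>b z\<bar> + \<bar>c z\<bar>) powr q" using q by (intro powr_mono2) auto
    also have "\<dots> \<le> ?ka * \<bar>b z\<bar> powr q + ?kb * \<bar>c z\<bar> powr q"
      using powr_add_le_weighted[of "\<bar>b z\<bar>" "\<bar>c z\<bar>" A B q] AB q by (simp add: algebra_simps)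
    finally have "ennreal (\<bar>b z + c z\<bar> powr q) \<le> ennreal ?ka * ennreal (\<bar>b z\<bar> powr q) + ennreal ?kb * ennreal (\<bar>c z\<bar> powr q)"
      by (simp add: ennreal_mult[symmetric] ennreal_plus[symmetric] ennreal_leI del: ennreal_plus)
    then show "ennreal (\<bar>b z + c z\<bar> powr q) * indicator S z
        \<le> ennreal ?ka * (ennreal (\<bar>b z\<bar> powr q) * indicator S z) + ennreal ?kb * (ennreal (\<bar>c z\<bar> powr q) * indicator S z)"
      by (auto split: split_indicator)
  qed
  also have "\<dots> = ennreal ?ka * (\<integral>\<^sup>+ z. ennreal (\<bar>b z\<bar> powr q) * indicator S z \<partial>M)
      + ennreal ?kb * (\<integral>\<^sup>+ z. ennreal (\<bar>c z\<bar> powr q) * indicator S z \<partial>M)"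
    by (subst nn_integral_add) (auto simp: nn_integral_cmult)
  also have "\<dots> \<le> ennreal ?ka * ennreal (A powr q) + ennreal ?kb * ennreal (B powr q)"
    using b c by (intro add_mono mult_left_mono) auto
  also have "\<dots> = ennreal (?ka * A powr q + ?kb * B powr q)"
    by (simp add: ennreal_mult[symmetric] ennreal_plus[symmetric] del: ennreal_plus)
  also have "?ka * A powr q + ?kb * B powr q = ?k * (A powr (1 - q + q) + B powr (1 - q + q))"
    unfolding powr_add by (simp add: algebra_simps)
  also have "\<dots> = (A + B) powr (q - 1) * (A + B) powr 1" using AB by simp
  also have "\<dots> = (A + B) powr q" unfolding powr_add[symmetric] by simp
  finally show ?thesis .
qed

section \<open>Roots of extended nonnegative reals\<close>

lemma enn_powr_less_iff:
  assumes "0 \<le> v" "0 < q"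
  shows "ennreal v < enn_powr X (1 / q) \<longleftrightarrow> ennreal (v powr q) < X"
proof (cases X)
  case (real R)
  have "v < R powr (1 / q) \<longleftrightarrow> v powr q < R"
  proof
    assume "v < R powr (1 / q)"
    then have "v powr q < (R powr (1 / q)) powr q" using assms by (intro powr_less_mono2) auto
    then show "v powr q < R" using real assms by (simp add: powr_powr)
  next
    assume "v powr q < R"
    then have "(v powr q) powr (1 / q) < R powr (1 / q)" using assms by (intro powr_less_mono2) auto
    then show "v < R powr (1 / q)" using assms by (simp add: powr_powr)
  qed
  then show ?thesis using real assms by (simp add: enn_powr_def ennreal_less_iff)
qed (simp add: enn_powr_def)

lemma enn_powr_le_iff:
  assumes "0 \<le> v" "0 < q"
  shows "enn_powr X (1 / q) \<le> ennreal v \<longleftrightarrow> X \<le> ennreal (v powr q)"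
  using enn_powr_less_iff[OF assms, of X] by (simp add: not_less[symmetric])

lemma measurable_enn_powr [measurable]: "(\<lambda>x. enn_powr x r) \<in> borel_measurable borel"
  unfolding enn_powr_def by measurable

text \<open>The weak-type estimate with A = N^q and \<beta> = 1 - q/p. The factor 1/\<beta> of the
  integrated power becomes \<beta>^(-1/q) in the norm, which is the origin of the constant
  C(p,q).\<close>

lemma weakLp_norm_integral_le:
  fixes r :: "real \<Rightarrow> ennreal"
  assumes [measurable]: "r \<in> borel_measurable lborel" "E \<in> sets lborel"
    and q: "0 < q" and p: "0 \<le> pinv p" "q * pinv p < 1" and fin: "emeasure lborel E < \<infinity>"
    and N: "weakLp_norm p (\<lambda>x. enn_powr (r x) (1 / q)) \<le> ennreal N" "0 \<le> N"
  shows "(\<integral>\<^sup>+ x. r x * indicator E x \<partial>lborel)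
    \<le> ennreal ((N * measure lborel E powr (1 / q - pinv p) / (1 - q * pinv p) powr (1 / q)) powr q)"
proof -
  define \<beta> where "\<beta> = 1 - q * pinv p"
  have \<beta>: "0 < \<beta>" "\<beta> \<le> 1" using p q by (auto simp: \<beta>_def)
  have "(\<integral>\<^sup>+ x. r x * indicator E x \<partial>lborel) \<le> ennreal (N powr q * measure lborel E powr \<beta> / \<beta>)"
  proof (rule weak_type_integral_le)
    fix s :: real assume s: "s > 0"
    have "(N * s powr - pinv p) powr q = N powr q * s powr (\<beta> - 1)"
      using N s by (simp add: powr_mult powr_powr \<beta>_def mult.commute)
    moreover have "emeasure lborel {x. ennreal (N * s powr - pinv p) < enn_powr (r x) (1 / q)} \<le> ennreal s"
      using N s by (intro weakLp_norm_level) measurable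
    ultimately show "emeasure lborel {x. ennreal (N powr q * s powr (\<beta> - 1)) < r x} \<le> ennreal s"
      using N s q by (simp add: enn_powr_less_iff)
  qed (use \<beta> fin assms(1,2) in auto)
  also have "N powr q * measure lborel E powr \<beta> / \<beta>
      = (N * measure lborel E powr (1 / q - pinv p) / \<beta> powr (1 / q)) powr q"
  proof -
    have "(1 / q - pinv p) * q = \<beta>" using q by (simp add: \<beta>_def algebra_simps)
    then show ?thesis using N q \<beta> by (simp add: powr_mult powr_divide powr_powr)
  qed
  finally show ?thesis by (simp add: \<beta>_def)
qed

lemma rectangle_le_row:
  assumes [measurable]: "f \<in> borel_measurable plane" "E \<in> sets lborel" "F \<in> sets lborel"
  shows "(\<integral>\<^sup>+ z. f z * indicator (E \<times> F) z \<partial>plane) \<le> (\<integral>\<^sup>+ x. (\<integral>\<^sup>+ y. f (x, y) \<partial>lborel) * indicator E x \<partial>lborel)"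
proof -
  have "(\<integral>\<^sup>+ z. f z * indicator (E \<times> F) z \<partial>plane)
      = (\<integral>\<^sup>+ x. \<integral>\<^sup>+ y. f (x, y) * indicator (E \<times> F) (x, y) \<partial>lborel \<partial>lborel)"
    by (rule lborel.nn_integral_fst[symmetric]) measurable
  also have "\<dots> \<le> (\<integral>\<^sup>+ x. \<integral>\<^sup>+ y. f (x, y) * indicator E x \<partial>lborel \<partial>lborel)"
    by (intro nn_integral_mono) (auto split: split_indicator)
  also have "\<dots> = (\<integral>\<^sup>+ x. (\<integral>\<^sup>+ y. f (x, y) \<partial>lborel) * indicator E x \<partial>lborel)"
    by (intro nn_integral_cong nn_integral_multc) measurable
  finally show ?thesis .
qed

lemma rectangle_le_col:
  assumes [measurable]: "f \<in> borel_measurable plane" "E \<in> sets lborel" "F \<in> sets lborel"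
  shows "(\<integral>\<^sup>+ z. f z * indicator (E \<times> F) z \<partial>plane) \<le> (\<integral>\<^sup>+ y. (\<integral>\<^sup>+ x. f (x, y) \<partial>lborel) * indicator F y \<partial>lborel)"
proof -
  have "(\<integral>\<^sup>+ z. f z * indicator (E \<times> F) z \<partial>plane)
      = (\<integral>\<^sup>+ y. \<integral>\<^sup>+ x. f (x, y) * indicator (E \<times> F) (x, y) \<partial>lborel \<partial>lborel)"
    by (rule lborel_pair.nn_integral_snd[symmetric]) measurable
  also have "\<dots> \<le> (\<integral>\<^sup>+ y. \<integral>\<^sup>+ x. f (x, y) * indicator F y \<partial>lborel \<partial>lborel)"
    by (intro nn_integral_mono) (auto split: split_indicator)
  also have "\<dots> = (\<integral>\<^sup>+ y. (\<integral>\<^sup>+ x. f (x, y) \<partial>lborel) * indicator F y \<partial>lborel)"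
    by (intro nn_integral_cong nn_integral_multc) measurable
  finally show ?thesis .
qed

lemma pinv_bounds:
  assumes "1 \<le> q" "ereal q < p"
  shows "0 \<le> pinv p" "q * pinv p < 1"
proof -
  have "0 \<le> pinv p \<and> q * pinv p < 1"
    using assms by (cases p) (auto simp: pinv_def field_simps)
  then show "0 \<le> pinv p" "q * pinv p < 1" by auto
qed

text \<open>On E \<times> F the norm of b is estimated through whole rows over E and that of c
  through whole columns over F; Minkowski adds the two. The maximum in the triple norm is what turns
  the two measure factors into the weights 1 and t.\<close>

lemma triple_norm_le_decomposition:
  assumes q: "1 \<le> q" and p: "ereal q < p" and t: "t > 0"
    and b: "b \<in> spaceA0 p q" and c: "c \<in> spaceA1 p q"
  shows "ennreal ((1 - q * pinv p) powr (1 / q)) * triple_norm p q t (\<lambda>z. b z + c z)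
    \<le> normA0 p q b + ennreal t * normA1 p q c"
proof -
  define C where "C = (1 - q * pinv p) powr (1 / q)"
  define \<alpha> where "\<alpha> = 1 / q - pinv p"
  note \<pi> = pinv_bounds[OF q p]
  have C: "0 < C" using \<pi> by (simp add: C_def)
  have [measurable]: "b \<in> borel_measurable plane" "c \<in> borel_measurable plane"
    using b c by (auto simp: spaceA0_def spaceA1_def)
  obtain N0 where N0: "normA0 p q b = ennreal N0" "0 \<le> N0"
    using b by (cases "normA0 p q b") (auto simp: spaceA0_def)
  obtain N1 where N1: "normA1 p q c = ennreal N1" "0 \<le> N1"
    using c by (cases "normA1 p q c") (auto simp: spaceA1_def)
  let ?I = "\<lambda>E F. \<integral>\<^sup>+ z. ennreal (\<bar>b z + c z\<bar> powr q) * indicator (E \<times> F) z \<partial>plane"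
  let ?M = "\<lambda>E F. max (measure lborel E powr \<alpha>) ((1 / t) * measure lborel F powr \<alpha>)"
  have bound: "ennreal C * (ennreal (1 / ?M E F) * enn_powr (?I E F) (1 / q))
      \<le> ennreal N0 + ennreal t * ennreal N1"
    if EF[measurable]: "E \<in> sets lborel" "F \<in> sets lborel"
      and pos: "0 < emeasure lborel E" "0 < emeasure lborel F"
      and fin: "emeasure lborel E < \<infinity>" "emeasure lborel F < \<infinity>" for E F
  proof (rule ennreal_le_epsilon)
    fix e :: real assume e: "e > 0"
    define mE where "mE = measure lborel E powr \<alpha>"
    define mF where "mF = measure lborel F powr \<alpha>"
    have mE: "0 < mE" and mF: "0 < mF"
      using pos fin by (auto simp: mE_def mF_def emeasure_eq_ennreal_measure)
    have M: "0 < ?M E F" using mE by (simp add: mE_def less_max_iff_disj)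
    \<comment> \<open>The errors e/2 and e/(2t) make both bounds positive and contribute e/2 + t
      e/(2t) = e to the weighted sum.\<close>
    define A where "A = (N0 + e / 2) * mE / C"
    define B where "B = (N1 + e / (2 * t)) * mF / C"
    have A: "0 < A" and B: "0 < B" using N0 N1 mE mF C e t by (auto simp: A_def B_def add_nonneg_pos)
    have "(\<integral>\<^sup>+ z. ennreal (\<bar>b z\<bar> powr q) * indicator (E \<times> F) z \<partial>plane)
        \<le> (\<integral>\<^sup>+ x. (\<integral>\<^sup>+ y. ennreal (\<bar>b (x, y)\<bar> powr q) \<partial>lborel) * indicator E x \<partial>lborel)"
      by (rule rectangle_le_row) measurable
    also have "\<dots> \<le> ennreal (((N0 + e / 2) * mE / C) powr q)"
      unfolding mE_def \<alpha>_def C_def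
      using q \<pi> fin N0 e EF
      by (intro weakLp_norm_integral_le) (auto simp: normA0_def slice_norm_x_def[abs_def] simp del: ennreal_plus)
    finally have b_le: "(\<integral>\<^sup>+ z. ennreal (\<bar>b z\<bar> powr q) * indicator (E \<times> F) z \<partial>plane) \<le> ennreal (A powr q)"
      by (simp add: A_def)
    have "(\<integral>\<^sup>+ z. ennreal (\<bar>c z\<bar> powr q) * indicator (E \<times> F) z \<partial>plane)
        \<le> (\<integral>\<^sup>+ y. (\<integral>\<^sup>+ x. ennreal (\<bar>c (x, y)\<bar> powr q) \<partial>lborel) * indicator F y \<partial>lborel)"
      by (rule rectangle_le_col) measurable
    also have "\<dots> \<le> ennreal (((N1 + e / (2 * t)) * mF / C) powr q)"
      unfolding mF_def \<alpha>_def C_def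
      using q \<pi> fin N1 e t EF
      by (intro weakLp_norm_integral_le) (auto simp: normA1_def slice_norm_y_def[abs_def] simp del: ennreal_plus)
    finally have c_le: "(\<integral>\<^sup>+ z. ennreal (\<bar>c z\<bar> powr q) * indicator (E \<times> F) z \<partial>plane) \<le> ennreal (B powr q)"
      by (simp add: B_def)
    have "?I E F \<le> ennreal ((A + B) powr q)"
      by (rule Minkowski_set_nn_integral[OF _ _ _ A B q b_le c_le]) measurable
    then have "enn_powr (?I E F) (1 / q) \<le> ennreal (A + B)"
      using A B q by (subst enn_powr_le_iff) auto
    then have "ennreal C * (ennreal (1 / ?M E F) * enn_powr (?I E F) (1 / q))
        \<le> ennreal C * (ennreal (1 / ?M E F) * ennreal (A + B))"
      by (intro mult_left_mono) auto
    also have "\<dots> = ennreal (C * (1 / ?M E F * (A + B)))"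
      using C M A B by (simp add: ennreal_mult[symmetric] del: ennreal_plus)
    also have "C * (1 / ?M E F * (A + B)) \<le> N0 + t * N1 + e"
    proof -
      have "mE \<le> ?M E F" "mF \<le> t * ?M E F"
        using t by (auto simp: mE_def mF_def max_def field_simps)
      then have "(N0 + e / 2) * mE + (N1 + e / (2 * t)) * mF
          \<le> (N0 + e / 2) * ?M E F + (N1 + e / (2 * t)) * (t * ?M E F)"
        using N0 N1 e t by (intro add_mono mult_left_mono) auto
      also have "\<dots> = (N0 + t * N1 + e) * ?M E F" using t by (simp add: field_simps)
      finally have "((N0 + e / 2) * mE + (N1 + e / (2 * t)) * mF) / ?M E F \<le> N0 + t * N1 + e"
        using M by (simp add: pos_divide_le_eq)
      moreover have "C * (1 / ?M E F * (A + B)) = ((N0 + e / 2) * mE + (N1 + e / (2 * t)) * mF) / ?M E F"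
      proof -
        have "C * (A + B) = (N0 + e / 2) * mE + (N1 + e / (2 * t)) * mF"
          using C by (simp add: A_def B_def distrib_left)
        then show ?thesis by (metis mult.left_commute mult_1 times_divide_eq_left)
      qed
      ultimately show ?thesis by (simp only:)
    qed
    also have "ennreal (N0 + t * N1 + e) = ennreal N0 + ennreal t * ennreal N1 + ennreal e"
      using N0 N1 t e by (simp add: ennreal_mult)
    finally show "ennreal C * (ennreal (1 / ?M E F) * enn_powr (?I E F) (1 / q))
        \<le> ennreal N0 + ennreal t * ennreal N1 + ennreal e" by (simp add: ennreal_leI)
  qed
  have "ennreal C * triple_norm p q t (\<lambda>z. b z + c z) \<le> ennreal N0 + ennreal t * ennreal N1"
    unfolding triple_norm_def SUP_mult_left_ennreal \<alpha>_def[symmetric]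
  proof (rule SUP_least, unfold mem_Collect_eq split_beta, elim conjE)
    fix EF :: "real set \<times> real set"
    assume "fst EF \<in> sets lborel" "snd EF \<in> sets lborel"
      "0 < emeasure lborel (fst EF)" "emeasure lborel (fst EF) < \<infinity>"
      "0 < emeasure lborel (snd EF)" "emeasure lborel (snd EF) < \<infinity>"
    then show "ennreal C * (ennreal (1 / ?M (fst EF) (snd EF)) * enn_powr (?I (fst EF) (snd EF)) (1 / q))
        \<le> ennreal N0 + ennreal t * ennreal N1" by (intro bound)
  qed
  then show ?thesis by (simp add: C_def N0 N1)
qed

lemma triple_norm_le_Kfun:
  assumes "1 \<le> q" "ereal q < p" "t > 0"
  shows "ennreal ((1 - q * pinv p) powr (1 / q)) * triple_norm p q t a \<le> Kfun p q t a"
  unfolding Kfun_def using triple_norm_le_decomposition[OF assms] by (intro Inf_greatest) auto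

section \<open>Limits of decreasing convex sets\<close>

text \<open>The Hilbert space argument for nearest points in convex sets: by the parallelogram law,
  near-minimisers of the L^2 norm on the sets A n form a Cauchy sequence, and a fast subsequence
  converges almost everywhere. No closedness is involved, as no limit is claimed to lie in any of
  the sets.\<close>

lemma (in finite_measure) convex_decseq_AE_convergent:
  fixes A :: "nat \<Rightarrow> ('a \<Rightarrow> real) set"
  assumes meas: "\<And>n \<theta>. \<theta> \<in> A n \<Longrightarrow> \<theta> \<in> borel_measurable M"
    and bd: "\<And>n \<theta> x. \<theta> \<in> A n \<Longrightarrow> 0 \<le> \<theta> x \<and> \<theta> x \<le> 1"
    and dec: "decseq A" and ne: "\<And>n. A n \<noteq> {}"
    and mid: "\<And>n \<theta> \<eta>. \<theta> \<in> A n \<Longrightarrow> \<eta> \<in> A n \<Longrightarrow> (\<lambda>x. (\<theta> x + \<eta> x) / 2) \<in> A n"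
  shows "\<exists>\<psi>. (\<forall>n. \<psi> n \<in> A n) \<and> (AE x in M. convergent (\<lambda>n. \<psi> n x))"
proof -
  let ?Q = "\<lambda>\<theta>. \<integral>x. (\<theta> x)\<^sup>2 \<partial>M"
  define I where "I n = (INF \<theta>\<in>A n. ?Q \<theta>)" for n
  have sq_le: "(\<theta> x)\<^sup>2 \<le> 1" if "\<theta> \<in> A n" for \<theta> n x
    using bd[OF that, of x] by (simp add: power_le_one)
  have int_sq: "integrable M (\<lambda>x. (\<theta> x)\<^sup>2)" if "\<theta> \<in> A n" for \<theta> n
    using meas[OF that] sq_le[OF that] by (intro integrable_const_bound[of _ 1]) auto
  have below: "bdd_below (?Q ` A n)" for n by (intro bdd_belowI[of _ 0]) auto
  have I_le: "I n \<le> ?Q \<theta>" if "\<theta> \<in> A n" for \<theta> n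
    unfolding I_def using below that by (rule cINF_lower)
  have Q_le: "?Q \<theta> \<le> measure M (space M)" if "\<theta> \<in> A n" for \<theta> n
  proof -
    have "?Q \<theta> \<le> (\<integral>x. 1 \<partial>M)" using int_sq[OF that] sq_le[OF that] by (intro integral_mono) auto
    then show ?thesis by simp
  qed
  \<comment> \<open>The minimal values increase as the sets shrink and are bounded by the total
    mass, so they are Cauchy.\<close>
  have "incseq I"
    unfolding incseq_def I_def using dec ne below
    by (auto intro!: cINF_superset_mono simp: decseq_def)
  moreover have "I n \<le> measure M (space M)" for n
    using ne[of n] I_le Q_le by (metis all_not_in_conv order_trans)
  ultimately have "convergent I" by (metis incseq_convergent convergentI)
  then have "Cauchy I" by (rule convergent_Cauchy)
  have "\<exists>\<theta>\<in>A n. ?Q \<theta> < I n + 1 / Suc n" for n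
    using cINF_less_iff[OF ne[of n] below[of n], of "I n + 1 / Suc n"] by (simp add: I_def)
  then obtain \<phi> where \<phi>: "\<And>n. \<phi> n \<in> A n" and \<phi>_lt: "\<And>n. ?Q (\<phi> n) < I n + 1 / Suc n" by metis
  note [measurable] = meas[OF \<phi>]
  have \<phi>_bd: "0 \<le> \<phi> n x" "\<phi> n x \<le> 1" for n x using bd[OF \<phi>] by auto
  have int_diff: "integrable M (\<lambda>x. (\<phi> n x - \<phi> m x)\<^sup>2)" for n m
  proof (intro integrable_const_bound[of _ 1] AE_I2)
    fix x
    have "\<bar>\<phi> n x - \<phi> m x\<bar> \<le> 1" using \<phi>_bd[of n x] \<phi>_bd[of m x] by linarith
    then show "norm ((\<phi> n x - \<phi> m x)\<^sup>2) \<le> 1" by (simp add: abs_square_le_1)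
  qed measurable
  \<comment> \<open>Parallelogram law: since m \<ge> n, the midpoint of \<open>\<phi> n\<close> and
    \<open>\<phi> m\<close> lies in \<open>A n\<close>, so its squared norm is at least
    \<open>I n\<close>.\<close>
  have \<phi>_close: "(\<integral>x. (\<phi> n x - \<phi> m x)\<^sup>2 \<partial>M) \<le> 2 * (I m - I n) + 2 / Suc n + 2 / Suc m"
    if "n \<le> m" for n m
  proof -
    have m: "\<phi> m \<in> A n" using \<phi>[of m] dec that by (auto simp: decseq_def)
    let ?a = "\<lambda>x. (\<phi> n x + \<phi> m x) / 2"
    have a: "?a \<in> A n" using mid[OF \<phi> m] .
    have "(\<integral>x. (\<phi> n x - \<phi> m x)\<^sup>2 \<partial>M) = (\<integral>x. 2 * (\<phi> n x)\<^sup>2 + 2 * (\<phi> m x)\<^sup>2 - 4 * (?a x)\<^sup>2 \<partial>M)"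
      by (intro Bochner_Integration.integral_cong) (auto simp: power2_eq_square field_simps)
    also have "\<dots> = 2 * ?Q (\<phi> n) + 2 * ?Q (\<phi> m) - 4 * ?Q ?a"
      using int_sq[OF \<phi>] int_sq[OF a] by simp
    also have "\<dots> \<le> 2 * (I n + 1 / Suc n) + 2 * (I m + 1 / Suc m) - 4 * I n"
      using \<phi>_lt[of n] \<phi>_lt[of m] I_le[OF a]
      by (intro diff_mono add_mono mult_left_mono) auto
    finally show ?thesis by (simp add: algebra_simps)
  qed
  have "\<exists>N. \<forall>n\<ge>N. \<forall>m\<ge>N. (\<integral>x. (\<phi> n x - \<phi> m x)\<^sup>2 \<partial>M) \<le> 6 / 4 ^ j" for j :: nat
  proof -
    obtain N1 where N1: "\<And>m n. N1 \<le> m \<Longrightarrow> N1 \<le> n \<Longrightarrow> dist (I m) (I n) < 1 / 4 ^ j"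
      using metric_CauchyD[OF \<open>Cauchy I\<close>, of "1 / 4 ^ j"] by auto
    \<comment> \<open>Beyond \<open>N1\<close> the minimal values differ by at most 4^(-j), and
      beyond 4^j the errors \<open>1 / Suc k\<close> are that small; with the factors 2 this gives
      6/4^j.\<close>
    let ?N = "max N1 (4 ^ j)"
    have *: "(\<integral>x. (\<phi> n x - \<phi> m x)\<^sup>2 \<partial>M) \<le> 6 / 4 ^ j" if "n \<ge> ?N" "m \<ge> n" for n m
    proof -
      have inv: "1 / Suc k \<le> 1 / (4::real) ^ j" if "k \<ge> ?N" for k
      proof -
        have "(4::nat) ^ j \<le> Suc k" using that by simp
        then have "(4::real) ^ j \<le> real (Suc k)" by (metis of_nat_le_iff of_nat_numeral of_nat_power)
        then show ?thesis by (intro divide_left_mono) auto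
      qed
      have "I m - I n \<le> 1 / 4 ^ j" using N1[of m n] that by (simp add: dist_real_def)
      then show ?thesis using \<phi>_close[OF that(2)] inv[of n] inv[of m] that by simp
    qed
    have "(\<integral>x. (\<phi> n x - \<phi> m x)\<^sup>2 \<partial>M) \<le> 6 / 4 ^ j" if "n \<ge> ?N" "m \<ge> ?N" for n m
      using *[of n m] *[of m n] that by (cases "n \<le> m") (auto simp: power2_commute)
    then show ?thesis by blast
  qed
  then obtain N where N: "\<And>j n m. n \<ge> N j \<Longrightarrow> m \<ge> N j \<Longrightarrow> (\<integral>x. (\<phi> n x - \<phi> m x)\<^sup>2 \<partial>M) \<le> 6 / 4 ^ j"
    by metis
  \<comment> \<open>The summand \<open>j\<close> ensures that \<open>\<psi> j\<close> lies in
    \<open>A j\<close>; the partial sums put both \<open>K j\<close> and \<open>K (Suc j)\<close>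
    beyond \<open>N j\<close>, so consecutive terms are close.\<close>
  define K where "K j = j + (\<Sum>i\<le>j. N i)" for j
  have K: "N j \<le> K j" "N j \<le> K (Suc j)" for j
    unfolding K_def using member_le_sum[of j "{..j}" N] by auto
  define \<psi> where "\<psi> j = \<phi> (K j)" for j
  have \<psi>: "\<psi> j \<in> A j" for j
    using \<phi>[of "K j"] decseqD[OF dec, of j "K j"] by (auto simp: \<psi>_def K_def)
  note [measurable] = meas[OF \<psi>]
  let ?d = "\<lambda>j x. \<psi> (Suc j) x - \<psi> j x"
  have "(\<integral>\<^sup>+x. ennreal \<bar>?d j x\<bar> \<partial>M) \<le> ennreal ((measure M (space M) + 6) * (1/2) ^ j)" for j
  proof -
    have int: "integrable M (\<lambda>x. (1/2) ^ j + 2 ^ j * (?d j x)\<^sup>2)"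
      using int_diff unfolding \<psi>_def by simp
    have "(\<integral>\<^sup>+x. ennreal \<bar>?d j x\<bar> \<partial>M) \<le> (\<integral>\<^sup>+x. ennreal ((1/2) ^ j + 2 ^ j * (?d j x)\<^sup>2) \<partial>M)"
    proof (intro nn_integral_mono ennreal_leI)
      fix x
      \<comment> \<open>This replaces the Cauchy-Schwarz inequality: either |u| is at most 2^(-j),
        or |u| is at most 2^j u^2. It turns the L^2 bound 6/4^j into an L^1 bound of order 2^(-j),
        summable over j.\<close>
      have "\<bar>u\<bar> \<le> (1/2) ^ j + 2 ^ j * u\<^sup>2" for u :: real
      proof (cases "\<bar>u\<bar> \<le> (1/2) ^ j")
        case False
        then have "1 \<le> 2 ^ j * \<bar>u\<bar>" by (simp add: field_simps)
        then have "\<bar>u\<bar> * 1 \<le> \<bar>u\<bar> * (2 ^ j * \<bar>u\<bar>)" by (intro mult_left_mono) auto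
        also have "\<dots> = 2 ^ j * u\<^sup>2" by (simp add: power2_eq_square flip: abs_mult)
        finally show ?thesis by (simp add: add_increasing)
      qed (simp add: add_increasing2)
      then show "\<bar>?d j x\<bar> \<le> (1/2) ^ j + 2 ^ j * (?d j x)\<^sup>2" .
    qed
    also have "\<dots> = ennreal (\<integral>x. (1/2) ^ j + 2 ^ j * (?d j x)\<^sup>2 \<partial>M)"
      using int by (intro nn_integral_eq_integral) auto
    also have "(\<integral>x. (1/2) ^ j + 2 ^ j * (?d j x)\<^sup>2 \<partial>M)
        = measure M (space M) * (1/2) ^ j + 2 ^ j * (\<integral>x. (?d j x)\<^sup>2 \<partial>M)"
      using int_diff unfolding \<psi>_def by simp
    also have "\<dots> \<le> measure M (space M) * (1/2) ^ j + 2 ^ j * (6 / 4 ^ j)"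
      using N[OF K(2) K(1)] unfolding \<psi>_def by (intro add_left_mono mult_left_mono) auto
    also have "\<dots> = (measure M (space M) + 6) * (1/2) ^ j"
    proof -
      have "(4::real) ^ j = 2 ^ j * 2 ^ j" by (simp flip: power_mult_distrib)
      then show ?thesis by (simp add: field_simps)
    qed
    finally show ?thesis by (simp add: ennreal_leI)
  qed
  then have "(\<Sum>j. \<integral>\<^sup>+x. ennreal \<bar>?d j x\<bar> \<partial>M) \<le> (\<Sum>j. ennreal ((measure M (space M) + 6) * (1/2) ^ j))"
    by (intro suminf_le) auto
  also have "\<dots> < \<infinity>"
    by (subst suminf_ennreal2) (auto intro!: summable_mult summable_geometric)
  finally have "(\<integral>\<^sup>+x. (\<Sum>j. ennreal \<bar>?d j x\<bar>) \<partial>M) < \<infinity>"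
    by (subst nn_integral_suminf) auto
  then have "AE x in M. (\<Sum>j. ennreal \<bar>?d j x\<bar>) \<noteq> \<infinity>"
    by (intro nn_integral_PInf_AE) auto
  then have "AE x in M. convergent (\<lambda>n. \<psi> n x)"
  proof eventually_elim
    fix x assume "(\<Sum>j. ennreal \<bar>?d j x\<bar>) \<noteq> \<infinity>"
    then have "summable (\<lambda>j. \<bar>?d j x\<bar>)" by (intro summable_suminf_not_top) auto
    then have "summable (\<lambda>j. ?d j x)" by (rule summable_rabs_cancel)
    \<comment> \<open>The partial sums of the absolutely convergent series of differences
      telescope.\<close>
    then have "convergent (\<lambda>n. \<psi> n x - \<psi> 0 x)"
      by (simp add: summable_iff_convergent sum_lessThan_telescope[of "\<lambda>n. \<psi> n x"])
    then have "convergent (\<lambda>n. (\<psi> n x - \<psi> 0 x) + \<psi> 0 x)" by (intro convergent_add convergent_const)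
    then show "convergent (\<lambda>n. \<psi> n x)" by simp
  qed
  with \<psi> show ?thesis by blast
qed

section \<open>Peeling light rows and columns\<close>

definition row_mass :: "(real \<times> real \<Rightarrow> ennreal) \<Rightarrow> real set \<Rightarrow> real \<Rightarrow> ennreal" where
  "row_mass f F x = (\<integral>\<^sup>+ y. f (x, y) * indicator F y \<partial>lborel)"

definition col_mass :: "(real \<times> real \<Rightarrow> ennreal) \<Rightarrow> real set \<Rightarrow> real \<Rightarrow> ennreal" where
  "col_mass f E y = (\<integral>\<^sup>+ x. f (x, y) * indicator E x \<partial>lborel)"

text \<open>Each round tests the rows against the current columns, and then the columns against the
  rows that have just survived. Rows thus leave first within a round, which decides ties in the
  assignment of points below.\<close>

primrec peel :: "(real \<times> real \<Rightarrow> ennreal) \<Rightarrow> ennreal \<Rightarrow> ennreal \<Rightarrow> real set \<Rightarrow> real set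
    \<Rightarrow> nat \<Rightarrow> real set \<times> real set" where
  "peel f c d X Y 0 = (X, Y)"
| "peel f c d X Y (Suc i) =
     (let E = fst (peel f c d X Y i); F = snd (peel f c d X Y i);
          E' = {x \<in> E. c < row_mass f F x}
      in (E', {y \<in> F. d < col_mass f E' y}))"

definition core_row where "core_row f c d X Y = (\<Inter>i. fst (peel f c d X Y i))"
definition core_col where "core_col f c d X Y = (\<Inter>i. snd (peel f c d X Y i))"

lemma row_mass_mono: "F \<subseteq> F' \<Longrightarrow> row_mass f F x \<le> row_mass f F' x"
  unfolding row_mass_def by (intro nn_integral_mono mult_left_mono) (auto split: split_indicator)

lemma col_mass_mono: "E \<subseteq> E' \<Longrightarrow> col_mass f E x \<le> col_mass f E' x"
  unfolding col_mass_def by (intro nn_integral_mono mult_left_mono) (auto split: split_indicator)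

lemma measurable_row_mass [measurable]:
  assumes [measurable]: "f \<in> borel_measurable plane" "F \<in> sets lborel"
  shows "row_mass f F \<in> borel_measurable lborel"
  unfolding row_mass_def[abs_def] by measurable

lemma measurable_col_mass [measurable]:
  assumes [measurable]: "f \<in> borel_measurable plane" "E \<in> sets lborel"
  shows "col_mass f E \<in> borel_measurable lborel"
  unfolding col_mass_def[abs_def] by measurable

section \<open>Measurability and monotonicity of the peeling\<close>

lemma peel_sets:
  assumes [measurable]: "f \<in> borel_measurable plane" and "X \<in> sets lborel" "Y \<in> sets lborel"
  shows "fst (peel f c d X Y i) \<in> sets lborel \<and> snd (peel f c d X Y i) \<in> sets lborel"
proof (induction i)
  case (Suc i)
  define E where "E = fst (peel f c d X Y i)"
  define F where "F = snd (peel f c d X Y i)"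
  have [measurable]: "E \<in> sets lborel" "F \<in> sets lborel"
    using Suc by (auto simp: E_def F_def)
  define E' where "E' = {x \<in> E. c < row_mass f F x}"
  have "E' = E \<inter> {x \<in> space lborel. c < row_mass f F x}" by (auto simp: E'_def)
  also have "\<dots> \<in> sets lborel" by measurable
  finally have [measurable]: "E' \<in> sets lborel" .
  have "{y \<in> F. d < col_mass f E' y} = F \<inter> {y \<in> space lborel. d < col_mass f E' y}" by auto
  also have "\<dots> \<in> sets lborel" by measurable
  finally show ?case
    using \<open>E' \<in> sets lborel\<close> by (simp add: Let_def E_def[symmetric] F_def[symmetric] E'_def)
qed (use assms in auto)

lemma core_sets:
  assumes "f \<in> borel_measurable plane" "X \<in> sets lborel" "Y \<in> sets lborel"
  shows "core_row f c d X Y \<in> sets lborel" "core_col f c d X Y \<in> sets lborel"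
  unfolding core_row_def core_col_def using peel_sets[OF assms] by (auto intro!: sets.countable_INT'')

lemma decseq_peel:
  "decseq (\<lambda>i. fst (peel f c d X Y i))" "decseq (\<lambda>i. snd (peel f c d X Y i))"
  by (auto intro!: decseq_SucI simp: Let_def)

lemma core_subset: "core_row f c d X Y \<subseteq> X" "core_col f c d X Y \<subseteq> Y"
  unfolding core_row_def core_col_def by (auto dest!: spec[of _ 0])

text \<open>A larger set of columns gives each row more mass, and conversely, so whatever survives
  in the smaller rectangle survives in the larger one. This makes the cores grow with the square,
  and lets a core be peeled again at another level.\<close>

lemma peel_mono:
  assumes "X \<subseteq> X'" "Y \<subseteq> Y'"
  shows "fst (peel f c d X Y i) \<subseteq> fst (peel f c d X' Y' i) \<and>
         snd (peel f c d X Y i) \<subseteq> snd (peel f c d X' Y' i)"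
proof (induction i)
  case (Suc i)
  then have 1: "fst (peel f c d X Y (Suc i)) \<subseteq> fst (peel f c d X' Y' (Suc i))"
    by (auto simp: Let_def elim!: order.strict_trans2 intro!: row_mass_mono)
  have "snd (peel f c d X Y (Suc i)) =
      {y \<in> snd (peel f c d X Y i). d < col_mass f (fst (peel f c d X Y (Suc i))) y}" for X Y
    by (simp add: Let_def)
  with 1 Suc show ?case
    by (auto elim!: order.strict_trans2 intro!: col_mass_mono simp del: peel.simps)
qed (use assms in auto)

lemma core_mono:
  assumes "X \<subseteq> X'" "Y \<subseteq> Y'"
  shows "core_row f c d X Y \<subseteq> core_row f c d X' Y'" "core_col f c d X Y \<subseteq> core_col f c d X' Y'"
  unfolding core_row_def core_col_def using peel_mono[OF assms, of f c d]
  by (meson INF_mono UNIV_I)+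

text \<open>A point outside the core loses its row or its column in some round; \<open>G\<close>
  collects the points whose row goes first. A row leaving in round i has points of \<open>G\<close>
  only over the columns \<open>F i\<close>, where its mass is at most c; a column leaving in round i
  keeps only points with rows in \<open>E (Suc i)\<close>, where its mass is at most d. Core rows
  meet no point of \<open>G\<close>, core columns no point of the remainder.\<close>

lemma peel_assignment:
  fixes c d :: ennreal
  assumes f: "f \<in> borel_measurable plane" and XY: "X \<in> sets lborel" "Y \<in> sets lborel"
  defines "C \<equiv> core_row f c d X Y" and "D \<equiv> core_col f c d X Y"
  obtains G where "G \<in> sets plane" "G \<subseteq> (X - C) \<times> Y" "X \<times> Y - C \<times> D - G \<subseteq> X \<times> (Y - D)"
    "\<And>x. (\<integral>\<^sup>+ y. f (x, y) * indicator G (x, y) \<partial>lborel) \<le> c"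
    "\<And>y. (\<integral>\<^sup>+ x. f (x, y) * indicator (X \<times> Y - C \<times> D - G) (x, y) \<partial>lborel) \<le> d"
proof -
  define E where "E i = fst (peel f c d X Y i)" for i
  define F where "F i = snd (peel f c d X Y i)" for i
  have E0: "E 0 = X" and F0: "F 0 = Y" by (auto simp: E_def F_def)
  have ES: "E (Suc i) = {x \<in> E i. c < row_mass f (F i) x}"
    and FS: "F (Suc i) = {y \<in> F i. d < col_mass f (E (Suc i)) y}" for i
    by (auto simp: E_def F_def Let_def)
  have E_mono: "i \<le> j \<Longrightarrow> E j \<subseteq> E i" and F_mono: "i \<le> j \<Longrightarrow> F j \<subseteq> F i" for i j
    using decseq_peel[of f c d X Y] by (auto simp: E_def F_def decseq_def)
  have C: "C = (\<Inter>i. E i)" and D: "D = (\<Inter>i. F i)"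
    by (auto simp: C_def D_def E_def F_def core_row_def core_col_def)
  have [measurable]: "E i \<in> sets lborel" "F i \<in> sets lborel" for i
    using peel_sets[OF f XY] by (auto simp: E_def F_def)
  \<comment> \<open>Row x leaves in round i while column y is still in \<open>F i\<close>; a column
    leaving in the same round does so after the row.\<close>
  define G where "G = (\<Union>i. (E i - E (Suc i)) \<times> F i)"
  have drop_row: "\<exists>j\<le>i. x \<in> E j - E (Suc j)" if "x \<in> X" "x \<notin> E (Suc i)" for x i
    using that(2)
  proof (induction i)
    case (Suc i) then show ?case by (metis DiffI le_SucI order_refl)
  qed (use that E0 in auto)
  show ?thesis
  proof
    show "G \<in> sets plane" unfolding G_def by measurable
    show "G \<subseteq> (X - C) \<times> Y"
      using E_mono[OF le0] F_mono[OF le0] unfolding G_def C E0 F0 by blast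
    show "X \<times> Y - C \<times> D - G \<subseteq> X \<times> (Y - D)"
    proof
      fix z assume "z \<in> X \<times> Y - C \<times> D - G"
      then obtain x y where z: "z = (x, y)"
        and *: "x \<in> X" "y \<in> Y" "(x, y) \<notin> C \<times> D" "(x, y) \<notin> G" by auto
      have "y \<notin> D"
      proof
        assume "y \<in> D"
        with *(3) obtain i where "x \<notin> E i" by (auto simp: C)
        then have "x \<notin> E (Suc i)" using E_mono[of i "Suc i"] by auto
        from drop_row[OF *(1) this] \<open>y \<in> D\<close> *(4) show False by (auto simp: G_def D)
      qed
      with * z show "z \<in> X \<times> (Y - D)" by auto
    qed
    fix x
    show "(\<integral>\<^sup>+ y. f (x, y) * indicator G (x, y) \<partial>lborel) \<le> c"
    proof (cases "\<exists>i. x \<in> E i - E (Suc i)")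
      case True
      then obtain i where i: "x \<in> E i - E (Suc i)" by auto
      \<comment> \<open>A row leaves only once, so its section of \<open>G\<close> lies in the
        single set \<open>F i\<close>.\<close>
      have "j = i" if "x \<in> E j - E (Suc j)" for j
        using i that E_mono[of "Suc i" j] E_mono[of "Suc j" i] by (meson DiffD1 DiffD2 linorder_cases subsetD Suc_leI)
      then have "(\<integral>\<^sup>+ y. f (x, y) * indicator G (x, y) \<partial>lborel) \<le> row_mass f (F i) x"
        unfolding row_mass_def
        by (intro nn_integral_mono mult_left_mono) (auto simp: G_def split: split_indicator)
      also have "\<dots> \<le> c" using i by (auto simp: ES)
      finally show ?thesis .
    next
      case False
      then have "indicator G (x, y) = (0::ennreal)" for y by (auto simp: G_def indicator_def)
      then show ?thesis by simp
    qed
  next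
    fix y
    let ?H = "X \<times> Y - C \<times> D - G"
    show "(\<integral>\<^sup>+ x. f (x, y) * indicator ?H (x, y) \<partial>lborel) \<le> d"
    proof (cases "\<exists>i. y \<in> F i - F (Suc i)")
      case True
      then obtain i where i: "y \<in> F i - F (Suc i)" by auto
      \<comment> \<open>A row that left in a round j \<le> i did so while y was still in
        \<open>F j\<close>, which would put (x, y) into \<open>G\<close>.\<close>
      have "x \<in> E (Suc i)" if H: "(x, y) \<in> ?H" for x
      proof (rule ccontr)
        assume "x \<notin> E (Suc i)"
        then obtain j where j: "j \<le> i" "x \<in> E j - E (Suc j)" using drop_row[of x i] H by auto
        with F_mono[OF j(1)] i have "(x, y) \<in> G" by (auto simp: G_def)
        with H show False by auto
      qed
      then have "(\<integral>\<^sup>+ x. f (x, y) * indicator ?H (x, y) \<partial>lborel) \<le> col_mass f (E (Suc i)) y"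
        unfolding col_mass_def
        by (intro nn_integral_mono mult_left_mono) (auto split: split_indicator)
      also have "\<dots> \<le> d" using i by (simp add: FS not_less)
      finally show ?thesis .
    next
      case False
      then have in_D: "y \<in> D" if "y \<in> Y"
      proof -
        have "y \<in> F i" for i using False that by (induction i) (auto simp: F0)
        then show ?thesis by (auto simp: D)
      qed
      have "(x, y) \<notin> ?H" for x
      proof
        assume H: "(x, y) \<in> ?H"
        with in_D have "y \<in> D" by auto
        with H obtain i where "x \<notin> E i" by (auto simp: C)
        then have "x \<notin> E (Suc i)" using E_mono[of i "Suc i"] by auto
        from drop_row[OF _ this] H \<open>y \<in> D\<close> show False by (auto simp: G_def D)
      qed
      then have "indicator ?H (x, y) = (0::ennreal)" for x by (auto simp: indicator_def)
      then show ?thesis by simp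
    qed
  qed
qed

text \<open>Induction on the number of levels, smallest thresholds first: peel X \<times> Y at level
  0, then treat the remaining levels inside the core C \<times> D. A row outside C receives only
  points of the first peeling, with mass at most c 0 \<le> c j; a row in C receives none of these,
  so only the recursive assignment matters. Columns behave alike.\<close>

lemma chain_assignment:
  fixes c d :: "nat \<Rightarrow> ennreal"
  assumes f: "f \<in> borel_measurable plane"
    and "X \<in> sets lborel" "Y \<in> sets lborel" "incseq c" "incseq d"
  shows "\<exists>G\<in>sets plane. \<forall>j<m.
    (\<forall>x. x \<notin> core_row f (c j) (d j) X Y \<longrightarrow>
       (\<integral>\<^sup>+ y. f (x, y) * indicator (X \<times> Y \<inter> G) (x, y) \<partial>lborel) \<le> c j) \<and>
    (\<forall>y. y \<notin> core_col f (c j) (d j) X Y \<longrightarrow>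
       (\<integral>\<^sup>+ x. f (x, y) * indicator (X \<times> Y - G) (x, y) \<partial>lborel) \<le> d j)"
  using assms(2-)
proof (induction m arbitrary: c d X Y)
  case 0 show ?case by (intro bexI[of _ "{}"]) auto
next
  case (Suc m)
  define C where "C = core_row f (c 0) (d 0) X Y"
  define D where "D = core_col f (c 0) (d 0) X Y"
  have CD[measurable]: "C \<in> sets lborel" "D \<in> sets lborel"
    using core_sets[OF f Suc.prems(1,2)] by (auto simp: C_def D_def)
  have CX: "C \<subseteq> X" "D \<subseteq> Y" using core_subset by (auto simp: C_def D_def)
  obtain P where P[measurable]: "P \<in> sets plane" and PC: "P \<subseteq> (X - C) \<times> Y"
    and PD: "X \<times> Y - C \<times> D - P \<subseteq> X \<times> (Y - D)"
    and Prow: "\<And>x. (\<integral>\<^sup>+ y. f (x, y) * indicator P (x, y) \<partial>lborel) \<le> c 0"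
    and Pcol: "\<And>y. (\<integral>\<^sup>+ x. f (x, y) * indicator (X \<times> Y - C \<times> D - P) (x, y) \<partial>lborel) \<le> d 0"
    by (rule peel_assignment[OF f Suc.prems(1,2), of "c 0" "d 0", folded C_def D_def], rule that)
  have inc: "incseq (\<lambda>j. c (Suc j))" "incseq (\<lambda>j. d (Suc j))"
    using Suc.prems(3,4) by (auto simp: incseq_def)
  obtain Q where Q[measurable]: "Q \<in> sets plane"
    and Qrow: "\<And>j x. j < m \<Longrightarrow> x \<notin> core_row f (c (Suc j)) (d (Suc j)) C D \<Longrightarrow>
       (\<integral>\<^sup>+ y. f (x, y) * indicator (C \<times> D \<inter> Q) (x, y) \<partial>lborel) \<le> c (Suc j)"
    and Qcol: "\<And>j y. j < m \<Longrightarrow> y \<notin> core_col f (c (Suc j)) (d (Suc j)) C D \<Longrightarrow>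
       (\<integral>\<^sup>+ x. f (x, y) * indicator (C \<times> D - Q) (x, y) \<partial>lborel) \<le> d (Suc j)"
    using Suc.IH[OF CD inc] by (elim bexE) (rule that, assumption, blast+)
  define G where "G = P \<union> (C \<times> D \<inter> Q)"
  show ?case
  proof (intro bexI[of _ G] allI impI conjI)
    show "G \<in> sets plane" unfolding G_def by measurable
    fix j x assume j: "j < Suc m" and x: "x \<notin> core_row f (c j) (d j) X Y"
    show "(\<integral>\<^sup>+ y. f (x, y) * indicator (X \<times> Y \<inter> G) (x, y) \<partial>lborel) \<le> c j"
    proof (cases "x \<in> C")
      case False
      have "(\<integral>\<^sup>+ y. f (x, y) * indicator (X \<times> Y \<inter> G) (x, y) \<partial>lborel)
          \<le> (\<integral>\<^sup>+ y. f (x, y) * indicator P (x, y) \<partial>lborel)"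
        using False by (intro nn_integral_mono mult_left_mono) (auto simp: G_def split: split_indicator)
      also have "\<dots> \<le> c j" using Prow[of x] Suc.prems(3) by (meson incseq_def le0 order_trans)
      finally show ?thesis .
    next
      case True
      with x obtain i where i: "j = Suc i" by (cases j) (auto simp: C_def)
      \<comment> \<open>The core taken inside C \<times> D is contained in the one taken inside X
        \<times> Y, so x is outside both.\<close>
      have "x \<notin> core_row f (c (Suc i)) (d (Suc i)) C D"
        using x core_mono(1)[OF CX] i by blast
      from Qrow[OF _ this] j i
      have "(\<integral>\<^sup>+ y. f (x, y) * indicator (C \<times> D \<inter> Q) (x, y) \<partial>lborel) \<le> c j" by simp
      moreover have "(\<integral>\<^sup>+ y. f (x, y) * indicator (X \<times> Y \<inter> G) (x, y) \<partial>lborel)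
          \<le> (\<integral>\<^sup>+ y. f (x, y) * indicator (C \<times> D \<inter> Q) (x, y) \<partial>lborel)"
        using True PC
        by (intro nn_integral_mono mult_left_mono) (auto simp: G_def split: split_indicator)
      ultimately show ?thesis by simp
    qed
  next
    fix j y assume j: "j < Suc m" and y: "y \<notin> core_col f (c j) (d j) X Y"
    show "(\<integral>\<^sup>+ x. f (x, y) * indicator (X \<times> Y - G) (x, y) \<partial>lborel) \<le> d j"
    proof (cases "y \<in> D")
      case False
      have "(\<integral>\<^sup>+ x. f (x, y) * indicator (X \<times> Y - G) (x, y) \<partial>lborel)
          \<le> (\<integral>\<^sup>+ x. f (x, y) * indicator (X \<times> Y - C \<times> D - P) (x, y) \<partial>lborel)"
        using False by (intro nn_integral_mono mult_left_mono) (auto simp: G_def split: split_indicator)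
      also have "\<dots> \<le> d j" using Pcol[of y] Suc.prems(4) by (meson incseq_def le0 order_trans)
      finally show ?thesis .
    next
      case True
      with y obtain i where i: "j = Suc i" by (cases j) (auto simp: D_def)
      have "y \<notin> core_col f (c (Suc i)) (d (Suc i)) C D"
        using y core_mono(2)[OF CX] i by blast
      from Qcol[OF _ this] j i
      have "(\<integral>\<^sup>+ x. f (x, y) * indicator (C \<times> D - Q) (x, y) \<partial>lborel) \<le> d j" by simp
      moreover have "(\<integral>\<^sup>+ x. f (x, y) * indicator (X \<times> Y - G) (x, y) \<partial>lborel)
          \<le> (\<integral>\<^sup>+ x. f (x, y) * indicator (C \<times> D - Q) (x, y) \<partial>lborel)"
        using True PD
        by (intro nn_integral_mono mult_left_mono) (auto simp: G_def split: split_indicator)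
      ultimately show ?thesis by simp
    qed
  qed
qed

text \<open>A core row passes every test, so its mass over each \<open>F i\<close> exceeds c;
  integrating over C bounds the mass of C \<times> F i from below. The bound passes to the
  intersection by continuity from above of the measure with density f, for which the mass of X
  \<times> Y has to be finite.\<close>

lemma core_mass:
  fixes c d :: ennreal
  assumes f[measurable]: "f \<in> borel_measurable plane"
    and [measurable]: "X \<in> sets lborel" "Y \<in> sets lborel"
    and fin: "(\<integral>\<^sup>+ z. f z * indicator (X \<times> Y) z \<partial>plane) < \<infinity>"
  defines "C \<equiv> core_row f c d X Y" and "D \<equiv> core_col f c d X Y"
  shows "c * emeasure lborel C \<le> (\<integral>\<^sup>+ z. f z * indicator (C \<times> D) z \<partial>plane)"
    and "d * emeasure lborel D \<le> (\<integral>\<^sup>+ z. f z * indicator (C \<times> D) z \<partial>plane)"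
proof -
  define E where "E i = fst (peel f c d X Y i)" for i
  define F where "F i = snd (peel f c d X Y i)" for i
  have ES: "E (Suc i) = {x \<in> E i. c < row_mass f (F i) x}"
    and FS: "F (Suc i) = {y \<in> F i. d < col_mass f (E (Suc i)) y}" for i
    by (auto simp: E_def F_def Let_def)
  have C: "C = (\<Inter>i. E i)" and D: "D = (\<Inter>i. F i)"
    by (auto simp: C_def D_def E_def F_def core_row_def core_col_def)
  have [measurable]: "E i \<in> sets lborel" "F i \<in> sets lborel" for i
    using peel_sets[OF f assms(2,3)] by (auto simp: E_def F_def)
  have [measurable]: "C \<in> sets lborel" "D \<in> sets lborel"
    using core_sets[OF f assms(2,3)] by (auto simp: C_def D_def)
  have CX: "C \<subseteq> X" "D \<subseteq> Y" using core_subset by (auto simp: C_def D_def)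
  let ?\<nu> = "density plane f"
  have nu: "emeasure ?\<nu> A = (\<integral>\<^sup>+ z. f z * indicator A z \<partial>plane)" if "A \<in> sets plane" for A
    using that by (simp add: emeasure_density)
  have XY: "X \<times> Y \<in> sets plane" by measurable
  have finite_sub: "emeasure ?\<nu> (A \<times> B) \<noteq> \<infinity>" if "A \<subseteq> X" "B \<subseteq> Y" for A B
  proof -
    have "emeasure ?\<nu> (A \<times> B) \<le> emeasure ?\<nu> (X \<times> Y)"
      using that XY by (intro emeasure_mono) auto
    then show ?thesis using fin nu[OF XY] by auto
  qed
  have dec: "decseq E" "decseq F"
    using decseq_peel[of f c d X Y] by (simp_all add: E_def[abs_def] F_def[abs_def])
  have "E 0 = X" "F 0 = Y" by (auto simp: E_def F_def)
  then have EX: "E i \<subseteq> X" "F i \<subseteq> Y" for i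
    using decseqD[OF dec(1), of 0 i] decseqD[OF dec(2), of 0 i] by auto
  show "c * emeasure lborel C \<le> (\<integral>\<^sup>+ z. f z * indicator (C \<times> D) z \<partial>plane)"
  proof -
    have le: "c * emeasure lborel C \<le> emeasure ?\<nu> (C \<times> F i)" for i
    proof -
      have "c * emeasure lborel C = (\<integral>\<^sup>+ x. c * indicator C x \<partial>lborel)"
        by (rule nn_integral_cmult_indicator[symmetric]) measurable
      also have "\<dots> \<le> (\<integral>\<^sup>+ x. row_mass f (F i) x * indicator C x \<partial>lborel)"
      proof (intro nn_integral_mono)
        fix x
        have "c \<le> row_mass f (F i) x" if "x \<in> C"
        proof -
          from that have "x \<in> E (Suc i)" by (auto simp: C)
          then show ?thesis by (simp add: ES less_imp_le)
        qed
        then show "c * indicator C x \<le> row_mass f (F i) x * indicator C x"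
          by (auto split: split_indicator)
      qed
      also have "\<dots> = (\<integral>\<^sup>+ x. \<integral>\<^sup>+ y. f (x, y) * indicator (C \<times> F i) (x, y) \<partial>lborel \<partial>lborel)"
        unfolding row_mass_def
        by (subst nn_integral_multc[symmetric])
           (auto intro!: nn_integral_cong simp: indicator_times ac_simps)
      also have "\<dots> = emeasure ?\<nu> (C \<times> F i)"
        by (subst lborel.nn_integral_fst, measurable) (rule nu[symmetric], measurable)
      finally show ?thesis .
    qed
    have "range (\<lambda>i. C \<times> F i) \<subseteq> sets ?\<nu>" by (intro image_subsetI) (unfold sets_density, measurable)
    then have INF_eq: "(INF i. emeasure ?\<nu> (C \<times> F i)) = emeasure ?\<nu> (\<Inter>i. C \<times> F i)"
      using dec(2) finite_sub[OF CX(1) EX(2)]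
      by (intro INF_emeasure_decseq) (auto simp: decseq_def)
    have Inter_eq: "(\<Inter>i. C \<times> F i) = C \<times> D" by (auto simp: D)
    have "c * emeasure lborel C \<le> (INF i. emeasure ?\<nu> (C \<times> F i))"
      by (rule INF_greatest) (rule le)
    also have "\<dots> = emeasure ?\<nu> (C \<times> D)" unfolding INF_eq Inter_eq ..
    also have "\<dots> = (\<integral>\<^sup>+ z. f z * indicator (C \<times> D) z \<partial>plane)" by (rule nu) measurable
    finally show ?thesis .
  qed
  show "d * emeasure lborel D \<le> (\<integral>\<^sup>+ z. f z * indicator (C \<times> D) z \<partial>plane)"
  proof -
    \<comment> \<open>The shifted index occurs because columns are tested against
      \<open>E (Suc i)\<close>; dropping \<open>E 0\<close> does not change the intersection of a
      decreasing sequence.\<close>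
    have le: "d * emeasure lborel D \<le> emeasure ?\<nu> (E (Suc i) \<times> D)" for i
    proof -
      have "d * emeasure lborel D = (\<integral>\<^sup>+ y. d * indicator D y \<partial>lborel)"
        by (rule nn_integral_cmult_indicator[symmetric]) measurable
      also have "\<dots> \<le> (\<integral>\<^sup>+ y. col_mass f (E (Suc i)) y * indicator D y \<partial>lborel)"
      proof (intro nn_integral_mono)
        fix y
        have "d \<le> col_mass f (E (Suc i)) y" if "y \<in> D"
        proof -
          from that have "y \<in> F (Suc i)" by (auto simp: D)
          then show ?thesis by (simp add: FS less_imp_le)
        qed
        then show "d * indicator D y \<le> col_mass f (E (Suc i)) y * indicator D y"
          by (auto split: split_indicator)
      qed
      also have "\<dots> = (\<integral>\<^sup>+ y. \<integral>\<^sup>+ x. f (x, y) * indicator (E (Suc i) \<times> D) (x, y) \<partial>lborel \<partial>lborel)"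
        unfolding col_mass_def
        by (subst nn_integral_multc[symmetric])
           (auto intro!: nn_integral_cong simp: indicator_times ac_simps)
      also have "\<dots> = emeasure ?\<nu> (E (Suc i) \<times> D)"
        by (subst lborel_pair.nn_integral_snd, measurable) (rule nu[symmetric], measurable)
      finally show ?thesis .
    qed
    have "range (\<lambda>i. E (Suc i) \<times> D) \<subseteq> sets ?\<nu>" by (intro image_subsetI) (unfold sets_density, measurable)
    then have INF_eq: "(INF i. emeasure ?\<nu> (E (Suc i) \<times> D)) = emeasure ?\<nu> (\<Inter>i. E (Suc i) \<times> D)"
      using decseqD[OF dec(1)] finite_sub[OF EX(1) CX(2)]
      by (intro INF_emeasure_decseq decseq_SucI Sigma_mono) auto
    have Inter_eq: "(\<Inter>i. E (Suc i) \<times> D) = C \<times> D"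
      using decseq_SucD[OF dec(1)] unfolding C by blast
    have "d * emeasure lborel D \<le> (INF i. emeasure ?\<nu> (E (Suc i) \<times> D))"
      by (rule INF_greatest) (rule le)
    also have "\<dots> = emeasure ?\<nu> (C \<times> D)" unfolding INF_eq Inter_eq ..
    also have "\<dots> = (\<integral>\<^sup>+ z. f z * indicator (C \<times> D) z \<partial>plane)" by (rule nu) measurable
    finally show ?thesis .
  qed
qed

text \<open>Let M be the larger of |C| and |D|/\<kappa>. The lower bounds for the core mass together
  with \<open>H\<close> give A1 s^(\<beta>-1) M \<le> A M^\<beta>. If M > s, the left side is at
  least A1 M^\<beta>, contradicting A < A1. The factor 1/\<kappa> in d is what makes the two lower
  bounds take the same form.\<close>

lemma core_measure_le:
  fixes A A1 \<beta> \<kappa> s :: real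
  assumes f: "f \<in> borel_measurable plane"
    and XY: "X \<in> sets lborel" "Y \<in> sets lborel"
    and XY_fin: "emeasure lborel X < \<infinity>" "emeasure lborel Y < \<infinity>"
    and A: "0 \<le> A" "A < A1" and \<beta>: "\<beta> \<le> 1" and \<kappa>: "0 < \<kappa>" and s: "0 < s"
    and H: "\<And>E F. E \<in> sets lborel \<Longrightarrow> F \<in> sets lborel \<Longrightarrow> emeasure lborel E < \<infinity> \<Longrightarrow> emeasure lborel F < \<infinity> \<Longrightarrow>
      (\<integral>\<^sup>+ z. f z * indicator (E \<times> F) z \<partial>plane)
        \<le> ennreal (A * max (measure lborel E) (measure lborel F / \<kappa>) powr \<beta>)"
    and c: "c = ennreal (A1 * s powr (\<beta> - 1))" and d: "d = ennreal (A1 * s powr (\<beta> - 1) / \<kappa>)"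
  shows "emeasure lborel (core_row f c d X Y) \<le> ennreal s"
    and "emeasure lborel (core_col f c d X Y) \<le> ennreal (\<kappa> * s)"
proof -
  define C where "C = core_row f c d X Y"
  define D where "D = core_col f c d X Y"
  have CD: "C \<in> sets lborel" "D \<in> sets lborel"
    using core_sets[OF f XY] by (auto simp: C_def D_def)
  have sub: "C \<subseteq> X" "D \<subseteq> Y" using core_subset by (auto simp: C_def D_def)
  have "emeasure lborel C \<le> emeasure lborel X" "emeasure lborel D \<le> emeasure lborel Y"
    using sub XY by (auto intro: emeasure_mono)
  then have fin: "emeasure lborel C < \<infinity>" "emeasure lborel D < \<infinity>"
    using XY_fin by (auto intro: order.strict_trans1)
  have "(\<integral>\<^sup>+ z. f z * indicator (X \<times> Y) z \<partial>plane) < \<infinity>"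
    using H[OF XY XY_fin] by (rule order.strict_trans1) simp
  note mass = core_mass[OF f XY this, where c = c and d = d, folded C_def D_def]
  define m where "m = measure lborel C"
  define m' where "m' = measure lborel D"
  define M where "M = max m (m' / \<kappa>)"
  have m: "emeasure lborel C = ennreal m" "emeasure lborel D = ennreal m'" "0 \<le> m" "0 \<le> m'"
    using fin by (auto simp: m_def m'_def emeasure_eq_ennreal_measure)
  have M0: "0 \<le> M" using m by (simp add: M_def)
  have total: "(\<integral>\<^sup>+ z. f z * indicator (C \<times> D) z \<partial>plane) \<le> ennreal (A * M powr \<beta>)"
    using H[OF CD fin] by (simp add: M_def m_def m'_def)
  have "ennreal (A1 * s powr (\<beta> - 1) * m) \<le> ennreal (A * M powr \<beta>)"
    using mass(1) total A m by (simp add: c ennreal_mult)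
  then have 1: "A1 * s powr (\<beta> - 1) * m \<le> A * M powr \<beta>" using A by simp
  have "ennreal (A1 * s powr (\<beta> - 1) / \<kappa> * m') \<le> ennreal (A * M powr \<beta>)"
    using order_trans[OF mass(2) total] A m \<kappa> by (simp add: d ennreal_mult[symmetric])
  then have 2: "A1 * s powr (\<beta> - 1) * (m' / \<kappa>) \<le> A * M powr \<beta>" using A by simp
  have key: "A1 * s powr (\<beta> - 1) * M \<le> A * M powr \<beta>"
    using 1 2 by (simp add: M_def max_def split: if_splits)
  have "M \<le> s"
  proof (rule ccontr)
    assume "\<not> M \<le> s"
    then have Ms: "s < M" by simp
    have "A1 * M powr \<beta> = A1 * M powr (\<beta> - 1) * M"
      using Ms s by (simp add: powr_diff)
    also have "\<dots> \<le> A1 * s powr (\<beta> - 1) * M"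
      using Ms s A \<beta> by (intro mult_right_mono mult_left_mono powr_mono2') auto
    also note key
    finally show False using A Ms s by (simp add: mult_le_cancel_right)
  qed
  then have "m \<le> s" "m' \<le> \<kappa> * s" using \<kappa> by (auto simp: M_def field_simps)
  then show "emeasure lborel (core_row f c d X Y) \<le> ennreal s"
    "emeasure lborel (core_col f c d X Y) \<le> ennreal (\<kappa> * s)"
    using m by (auto simp: C_def[symmetric] D_def[symmetric] ennreal_leI)
qed

section \<open>Integral bounds under averages and limits\<close>

lemma nn_integral_midpoint_le:
  fixes g :: "'a \<Rightarrow> ennreal" and u v :: "'a \<Rightarrow> real"
  assumes [measurable]: "g \<in> borel_measurable M" "u \<in> borel_measurable M" "v \<in> borel_measurable M"
    and nn: "\<And>x. 0 \<le> u x" "\<And>x. 0 \<le> v x"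
    and u: "(\<integral>\<^sup>+ x. g x * ennreal (u x) \<partial>M) \<le> c" and v: "(\<integral>\<^sup>+ x. g x * ennreal (v x) \<partial>M) \<le> c"
  shows "(\<integral>\<^sup>+ x. g x * ennreal ((u x + v x) / 2) \<partial>M) \<le> c"
proof -
  have "(\<integral>\<^sup>+ x. g x * ennreal ((u x + v x) / 2) \<partial>M)
      = (\<integral>\<^sup>+ x. ennreal (1/2) * (g x * ennreal (u x)) + ennreal (1/2) * (g x * ennreal (v x)) \<partial>M)"
  proof (intro nn_integral_cong)
    fix x
    have "ennreal ((u x + v x) / 2) = ennreal (1/2 * u x + 1/2 * v x)" by (simp add: add_divide_distrib)
    also have "\<dots> = ennreal (1/2 * u x) + ennreal (1/2 * v x)"
      using nn[of x] by (intro ennreal_plus) auto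
    also have "\<dots> = ennreal (1/2) * ennreal (u x) + ennreal (1/2) * ennreal (v x)"
      using nn[of x] by (intro arg_cong2[where f = "(+)"] ennreal_mult) auto
    finally show "g x * ennreal ((u x + v x) / 2)
        = ennreal (1/2) * (g x * ennreal (u x)) + ennreal (1/2) * (g x * ennreal (v x))"
      by (simp only: distrib_left mult.left_commute)
  qed
  also have "\<dots> = ennreal (1/2) * (\<integral>\<^sup>+ x. g x * ennreal (u x) \<partial>M)
      + ennreal (1/2) * (\<integral>\<^sup>+ x. g x * ennreal (v x) \<partial>M)"
    by (subst nn_integral_add) (auto simp: nn_integral_cmult)
  also have "\<dots> \<le> ennreal (1/2) * c + ennreal (1/2) * c"
    using u v by (intro add_mono mult_left_mono) auto
  also have "\<dots> = (ennreal (1/2) + ennreal (1/2)) * c" by (rule distrib_right[symmetric])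
  also have "ennreal (1/2) + ennreal (1/2) = 1" by (subst ennreal_plus[symmetric]) auto
  finally show ?thesis by simp
qed

text \<open>Fatou's lemma; finiteness of \<open>g\<close> ensures that the products with
  \<open>u i\<close> converge wherever \<open>u i\<close> does, even to the limit 0.\<close>

lemma nn_integral_Fatou_le:
  fixes g :: "'a \<Rightarrow> ennreal" and u :: "nat \<Rightarrow> 'a \<Rightarrow> real"
  assumes [measurable]: "g \<in> borel_measurable M" "\<And>i. u i \<in> borel_measurable M"
    and g: "\<And>x. g x < \<infinity>" and conv: "AE x in M. (\<lambda>i. u i x) \<longlonglongrightarrow> v x"
    and le: "\<And>i. (\<integral>\<^sup>+ x. g x * ennreal (u i x) \<partial>M) \<le> c"
  shows "(\<integral>\<^sup>+ x. g x * ennreal (v x) \<partial>M) \<le> c"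
proof -
  have "(\<integral>\<^sup>+ x. g x * ennreal (v x) \<partial>M) = (\<integral>\<^sup>+ x. liminf (\<lambda>i. g x * ennreal (u i x)) \<partial>M)"
  proof (intro nn_integral_cong_AE)
    show "AE x in M. g x * ennreal (v x) = liminf (\<lambda>i. g x * ennreal (u i x))"
      using conv
    proof eventually_elim
      fix x assume "(\<lambda>i. u i x) \<longlonglongrightarrow> v x"
      then have "(\<lambda>i. g x * ennreal (u i x)) \<longlonglongrightarrow> g x * ennreal (v x)"
        using g[of x] by (intro ennreal_tendsto_cmult tendsto_ennrealI) auto
      then show "g x * ennreal (v x) = liminf (\<lambda>i. g x * ennreal (u i x))"
        by (intro lim_imp_Liminf[symmetric]) auto
    qed
  qed
  also have "\<dots> \<le> liminf (\<lambda>i. \<integral>\<^sup>+ x. g x * ennreal (u i x) \<partial>M)"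
    by (rule nn_integral_liminf) measurable
  also have "\<dots> \<le> c"
    using le by (intro order_trans[OF Liminf_le_Limsup Limsup_bounded]) (auto simp: eventually_sequentially)
  finally show ?thesis .
qed

section \<open>The upper bound\<close>

text \<open>Assignments on different squares need not be compatible, so a limit is taken; fractional
  values are allowed because indicators do not form a convex set. The exceptional sets are unions
  over all squares, hence the same for every n, and this lets the constraints on a square imply
  those on a smaller one.\<close>

lemma fractional_assignment:
  fixes f :: "real \<times> real \<Rightarrow> ennreal" and c d :: "int \<Rightarrow> ennreal"
  assumes f[measurable]: "f \<in> borel_measurable plane" and f_fin: "\<And>z. f z < \<infinity>"
    and c: "antimono c" and d: "antimono d"
  defines "B \<equiv> \<lambda>n::nat. {- real n..real n}"
  defines "D \<equiv> \<lambda>k. \<Union>n. core_row f (c k) (d k) (B n) (B n)"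
    and "D' \<equiv> \<lambda>k. \<Union>n. core_col f (c k) (d k) (B n) (B n)"
  obtains \<theta> :: "real \<times> real \<Rightarrow> real" where "\<theta> \<in> borel_measurable plane"
    "\<And>z. 0 \<le> \<theta> z \<and> \<theta> z \<le> 1"
    "\<And>k. AE x in lborel. x \<notin> D k \<longrightarrow> (\<integral>\<^sup>+ y. f (x, y) * ennreal (\<theta> (x, y)) \<partial>lborel) \<le> c k"
    "\<And>k. AE y in lborel. y \<notin> D' k \<longrightarrow> (\<integral>\<^sup>+ x. f (x, y) * ennreal (1 - \<theta> (x, y)) \<partial>lborel) \<le> d k"
proof -
  have B_sets[measurable]: "B n \<in> sets lborel" for n by (simp add: B_def)
  have B_mono: "n \<le> m \<Longrightarrow> B n \<subseteq> B m" for n m by (auto simp: B_def)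
  define g where "g n z = f z * indicator (B n \<times> B n) z" for n z
  have g_meas[measurable]: "g n \<in> borel_measurable plane" for n unfolding g_def by measurable
  have g_mono: "g n z \<le> g m z" if "n \<le> m" for n m z
    using B_mono[OF that] by (auto simp: g_def split: split_indicator)
  define row_ok where "row_ok n \<theta> k \<longleftrightarrow>
    (AE x in lborel. x \<notin> D k \<longrightarrow> (\<integral>\<^sup>+ y. g n (x, y) * ennreal (\<theta> (x, y)) \<partial>lborel) \<le> c k)" for n \<theta> k
  define col_ok where "col_ok n \<theta> k \<longleftrightarrow>
    (AE y in lborel. y \<notin> D' k \<longrightarrow> (\<integral>\<^sup>+ x. g n (x, y) * ennreal (1 - \<theta> (x, y)) \<partial>lborel) \<le> d k)" for n \<theta> k
  \<comment> \<open>Both the square and the finite range of levels grow with n, so the constraints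
    accumulate.\<close>
  define A where "A n = {\<theta> \<in> borel_measurable plane. (\<forall>z. 0 \<le> \<theta> z \<and> \<theta> z \<le> 1) \<and>
    (\<forall>k. \<bar>k\<bar> \<le> int n \<longrightarrow> row_ok n \<theta> k \<and> col_ok n \<theta> k)}" for n
  have "decseq A"
  proof (rule decseq_SucI, rule subsetI)
    fix n \<theta> assume \<theta>: "\<theta> \<in> A (Suc n)"
    have "row_ok n \<theta> k \<and> col_ok n \<theta> k" if k: "\<bar>k\<bar> \<le> int n" for k
    proof -
      from \<theta> k have *: "row_ok (Suc n) \<theta> k" "col_ok (Suc n) \<theta> k" by (auto simp: A_def)
      have r: "(\<integral>\<^sup>+ y. g n (x, y) * ennreal (\<theta> (x, y)) \<partial>lborel) \<le> (\<integral>\<^sup>+ y. g (Suc n) (x, y) * ennreal (\<theta> (x, y)) \<partial>lborel)" for x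
        by (intro nn_integral_mono mult_right_mono g_mono) auto
      have s: "(\<integral>\<^sup>+ x. g n (x, y) * ennreal (1 - \<theta> (x, y)) \<partial>lborel) \<le> (\<integral>\<^sup>+ x. g (Suc n) (x, y) * ennreal (1 - \<theta> (x, y)) \<partial>lborel)" for y
        by (intro nn_integral_mono mult_right_mono g_mono) auto
      have "row_ok n \<theta> k"
        using *(1) unfolding row_ok_def by eventually_elim (use r order_trans in blast)
      moreover have "col_ok n \<theta> k"
        using *(2) unfolding col_ok_def by eventually_elim (use s order_trans in blast)
      ultimately show ?thesis ..
    qed
    with \<theta> show "\<theta> \<in> A n" by (auto simp: A_def)
  qed
  have ne: "A n \<noteq> {}" for n
  proof -
    \<comment> \<open>The index j = 0, ..., 2n runs through the levels from n down to -n, so that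
      the thresholds increase as the chain requires.\<close>
    have inc: "incseq (\<lambda>j. c (int n - int j))" "incseq (\<lambda>j. d (int n - int j))"
      using c d by (auto simp: incseq_def antimono_def)
    obtain G where G[measurable]: "G \<in> sets plane" and "\<forall>j<2 * n + 1.
        (\<forall>x. x \<notin> core_row f (c (int n - int j)) (d (int n - int j)) (B n) (B n) \<longrightarrow>
          (\<integral>\<^sup>+ y. f (x, y) * indicator (B n \<times> B n \<inter> G) (x, y) \<partial>lborel) \<le> c (int n - int j)) \<and>
        (\<forall>y. y \<notin> core_col f (c (int n - int j)) (d (int n - int j)) (B n) (B n) \<longrightarrow>
          (\<integral>\<^sup>+ x. f (x, y) * indicator (B n \<times> B n - G) (x, y) \<partial>lborel) \<le> d (int n - int j))"
      using chain_assignment[OF f B_sets[of n] B_sets[of n] inc, of "2 * n + 1"]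
      by (elim bexE) (rule that)
    then have row: "\<And>j x. j < 2 * n + 1 \<Longrightarrow> x \<notin> core_row f (c (int n - int j)) (d (int n - int j)) (B n) (B n) \<Longrightarrow>
        (\<integral>\<^sup>+ y. f (x, y) * indicator (B n \<times> B n \<inter> G) (x, y) \<partial>lborel) \<le> c (int n - int j)"
      and col: "\<And>j y. j < 2 * n + 1 \<Longrightarrow> y \<notin> core_col f (c (int n - int j)) (d (int n - int j)) (B n) (B n) \<Longrightarrow>
        (\<integral>\<^sup>+ x. f (x, y) * indicator (B n \<times> B n - G) (x, y) \<partial>lborel) \<le> d (int n - int j)"
      by simp_all
    have "row_ok n (indicator G) k \<and> col_ok n (indicator G) k" if k: "\<bar>k\<bar> \<le> int n" for k
    proof -
      define j where "j = nat (int n - k)"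
      have j: "j < 2 * n + 1" "int n - int j = k" using k by (auto simp: j_def)
      have "(\<integral>\<^sup>+ y. g n (x, y) * ennreal (indicator G (x, y)) \<partial>lborel) \<le> c k" if "x \<notin> D k" for x
      proof -
        have "(\<integral>\<^sup>+ y. g n (x, y) * ennreal (indicator G (x, y)) \<partial>lborel)
            = (\<integral>\<^sup>+ y. f (x, y) * indicator (B n \<times> B n \<inter> G) (x, y) \<partial>lborel)"
          by (intro nn_integral_cong) (auto simp: g_def split: split_indicator)
        also have "\<dots> \<le> c k" using row[OF j(1), of x] that by (auto simp: j(2) D_def)
        finally show ?thesis .
      qed
      moreover have "(\<integral>\<^sup>+ x. g n (x, y) * ennreal (1 - indicator G (x, y)) \<partial>lborel) \<le> d k" if "y \<notin> D' k" for y
      proof -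
        have "(\<integral>\<^sup>+ x. g n (x, y) * ennreal (1 - indicator G (x, y)) \<partial>lborel)
            = (\<integral>\<^sup>+ x. f (x, y) * indicator (B n \<times> B n - G) (x, y) \<partial>lborel)"
          by (intro nn_integral_cong) (auto simp: g_def split: split_indicator)
        also have "\<dots> \<le> d k" using col[OF j(1), of y] that by (auto simp: j(2) D'_def)
        finally show ?thesis .
      qed
      ultimately show ?thesis by (auto simp: row_ok_def col_ok_def)
    qed
    then have "indicator G \<in> A n" by (auto simp: A_def)
    then show ?thesis by auto
  qed
  have mid: "(\<lambda>z. (\<theta> z + \<eta> z) / 2) \<in> A n" if "\<theta> \<in> A n" "\<eta> \<in> A n" for n \<theta> \<eta>
  proof -
    let ?m = "\<lambda>z. (\<theta> z + \<eta> z) / 2"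
    have [measurable]: "\<theta> \<in> borel_measurable plane" "\<eta> \<in> borel_measurable plane"
      and bd: "\<And>z. 0 \<le> \<theta> z" "\<And>z. \<theta> z \<le> 1" "\<And>z. 0 \<le> \<eta> z" "\<And>z. \<eta> z \<le> 1"
      using that by (auto simp: A_def)
    have "row_ok n ?m k \<and> col_ok n ?m k" if k: "\<bar>k\<bar> \<le> int n" for k
    proof
      have "row_ok n \<theta> k" "row_ok n \<eta> k" using \<open>\<theta> \<in> A n\<close> \<open>\<eta> \<in> A n\<close> k by (auto simp: A_def)
      then show "row_ok n ?m k" unfolding row_ok_def
      proof eventually_elim
        case (elim x)
        then show ?case using bd by (auto intro!: nn_integral_midpoint_le)
      qed
      have "col_ok n \<theta> k" "col_ok n \<eta> k" using \<open>\<theta> \<in> A n\<close> \<open>\<eta> \<in> A n\<close> k by (auto simp: A_def)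
      then show "col_ok n ?m k" unfolding col_ok_def
      proof eventually_elim
        case (elim y)
        \<comment> \<open>The complement of the midpoint is the midpoint of the complements.\<close>
        have eq: "1 - ?m z = ((1 - \<theta> z) + (1 - \<eta> z)) / 2" for z by (simp add: field_simps)
        from elim show ?case unfolding eq using bd by (intro impI nn_integral_midpoint_le) auto
      qed
    qed
    moreover have "0 \<le> ?m z \<and> ?m z \<le> 1" for z using bd[of z] by simp
    ultimately show ?thesis by (auto simp: A_def)
  qed
  have "sigma_finite_measure plane"
    unfolding lborel_prod by (rule sigma_finite_lborel)
  \<comment> \<open>A positive integrable weight gives a finite measure with the same null sets as
    the plane, on which the L^2 argument can be run.\<close>
  obtain h where h[measurable]: "h \<in> borel_measurable plane"
    and h_fin: "integral\<^sup>N plane h \<noteq> \<infinity>" and h_pos: "\<And>z. 0 < h z"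
    using sigma_finite_measure.Ex_finite_integrable_function[OF \<open>sigma_finite_measure plane\<close>] by (auto simp: space_pair_measure)
  interpret M: finite_measure "density plane h"
  proof (rule finite_measureI)
    have "emeasure (density plane h) (space plane) = (\<integral>\<^sup>+ z. h z * indicator (space plane) z \<partial>plane)"
      by (rule emeasure_density[OF h sets.top])
    also have "\<dots> = integral\<^sup>N plane h" by (intro nn_integral_cong) auto
    finally show "emeasure (density plane h) (space (density plane h)) \<noteq> \<infinity>" using h_fin by simp
  qed
  have "\<exists>\<psi>. (\<forall>n. \<psi> n \<in> A n) \<and> (AE z in density plane h. convergent (\<lambda>n. \<psi> n z))"
  proof (rule M.convex_decseq_AE_convergent[OF _ _ \<open>decseq A\<close> ne mid])
    show "\<theta> \<in> borel_measurable (density plane h)" if "\<theta> \<in> A n" for n \<theta>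
      using that by (simp add: A_def)
    show "0 \<le> \<theta> z \<and> \<theta> z \<le> 1" if "\<theta> \<in> A n" for n \<theta> z
      using that unfolding A_def by blast
  qed
  then obtain \<psi> where \<psi>: "\<And>n. \<psi> n \<in> A n" and "AE z in density plane h. convergent (\<lambda>n. \<psi> n z)" by blast
  then have conv: "AE z in plane. convergent (\<lambda>n. \<psi> n z)" using h_pos by (simp add: AE_density)
  have [measurable]: "\<psi> n \<in> borel_measurable plane" for n using \<psi>[of n] by (simp add: A_def)
  have \<psi>_bd: "0 \<le> \<psi> n z" "\<psi> n z \<le> 1" for n z using \<psi>[of n] unfolding A_def by blast+
  \<comment> \<open>Clamping keeps the values in [0, 1] also at points where the sequence diverges
    and \<open>lim\<close> is arbitrary.\<close>
  define \<theta> where "\<theta> z = max 0 (min 1 (lim (\<lambda>n. \<psi> n z)))" for z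
  have [measurable]: "\<theta> \<in> borel_measurable plane" unfolding \<theta>_def[abs_def] by measurable
  have "AE z in plane. (\<lambda>n. \<psi> n z) \<longlonglongrightarrow> \<theta> z"
    using conv
  proof eventually_elim
    case (elim z)
    then have l: "(\<lambda>n. \<psi> n z) \<longlonglongrightarrow> lim (\<lambda>n. \<psi> n z)" by (simp add: convergent_LIMSEQ_iff)
    have "0 \<le> lim (\<lambda>n. \<psi> n z)" using l \<psi>_bd[of _ z] by (intro LIMSEQ_le_const) auto
    moreover have "lim (\<lambda>n. \<psi> n z) \<le> 1" using l \<psi>_bd[of _ z] by (intro LIMSEQ_le_const2) auto
    ultimately show ?case using l by (simp add: \<theta>_def)
  qed
  then have tend: "AE x in lborel. AE y in lborel. (\<lambda>n. \<psi> n (x, y)) \<longlonglongrightarrow> \<theta> (x, y)"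
    by (rule lborel_pair.AE_pair)
  have tend': "AE y in lborel. AE x in lborel. (\<lambda>n. \<psi> n (x, y)) \<longlonglongrightarrow> \<theta> (x, y)"
  proof (subst lborel_pair.AE_commute[symmetric])
    show "{z \<in> space plane. (\<lambda>n. \<psi> n (fst z, snd z)) \<longlonglongrightarrow> \<theta> (fst z, snd z)} \<in> sets plane"
      by measurable
  qed (rule tend)
  \<comment> \<open>Every point lies in all sufficiently large squares, so the truncation disappears
    in the limit.\<close>
  have box_tend: "(\<lambda>i. indicator (B (i + K) \<times> B (i + K)) z * u (i + K)) \<longlonglongrightarrow> l"
    if "u \<longlonglongrightarrow> l" for u :: "nat \<Rightarrow> real" and l K z
  proof -
    obtain N :: nat where N: "\<bar>fst z\<bar> \<le> real N" "\<bar>snd z\<bar> \<le> real N"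
      using real_arch_simple[of "max \<bar>fst z\<bar> \<bar>snd z\<bar>"] by auto
    have "indicator (B n \<times> B n) z = (1::real)" if "n \<ge> N" for n
    proof -
      have "real N \<le> real n" using that by simp
      then have "z \<in> B n \<times> B n" using N unfolding B_def mem_Times_iff atLeastAtMost_iff by linarith
      then show ?thesis by simp
    qed
    then have "eventually (\<lambda>n. u n = indicator (B n \<times> B n) z * u n) sequentially"
      unfolding eventually_sequentially by (intro exI[of _ N]) auto
    then have "(\<lambda>n. indicator (B n \<times> B n) z * u n) \<longlonglongrightarrow> l"
      using that by (rule Lim_transform_eventually[rotated])
    then show ?thesis by (rule LIMSEQ_ignore_initial_segment)
  qed
  have "AE x in lborel. x \<notin> D k \<longrightarrow> (\<integral>\<^sup>+ y. f (x, y) * ennreal (\<theta> (x, y)) \<partial>lborel) \<le> c k" for k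
  proof -
    \<comment> \<open>Starting the sequence at |k| makes all of its terms obey the constraint at
      level k. The countably many exceptional null sets are then merged.\<close>
    define K where "K = nat \<bar>k\<bar>"
    have "AE x in lborel. \<forall>i. x \<notin> D k \<longrightarrow> (\<integral>\<^sup>+ y. g (i + K) (x, y) * ennreal (\<psi> (i + K) (x, y)) \<partial>lborel) \<le> c k"
    proof (subst AE_all_countable, rule allI)
      fix i
      have "\<bar>k\<bar> \<le> int (i + K)" by (simp add: K_def)
      then show "AE x in lborel. x \<notin> D k \<longrightarrow> (\<integral>\<^sup>+ y. g (i + K) (x, y) * ennreal (\<psi> (i + K) (x, y)) \<partial>lborel) \<le> c k"
        using \<psi>[of "i + K"] by (simp add: A_def row_ok_def)
    qed
    with tend show ?thesis
    proof eventually_elim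
      case (elim x)
      show ?case
      proof
        assume x: "x \<notin> D k"
        show "(\<integral>\<^sup>+ y. f (x, y) * ennreal (\<theta> (x, y)) \<partial>lborel) \<le> c k"
        proof (rule nn_integral_Fatou_le[where u = "\<lambda>i y. indicator (B (i + K) \<times> B (i + K)) (x, y) * \<psi> (i + K) (x, y)"])
          show "AE y in lborel. (\<lambda>i. indicator (B (i + K) \<times> B (i + K)) (x, y) * \<psi> (i + K) (x, y)) \<longlonglongrightarrow> \<theta> (x, y)"
            using elim(1) by eventually_elim (rule box_tend)
          fix i
          have "(\<integral>\<^sup>+ y. f (x, y) * ennreal (indicator (B (i + K) \<times> B (i + K)) (x, y) * \<psi> (i + K) (x, y)) \<partial>lborel)
              = (\<integral>\<^sup>+ y. g (i + K) (x, y) * ennreal (\<psi> (i + K) (x, y)) \<partial>lborel)"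
            by (intro nn_integral_cong) (auto simp: g_def split: split_indicator)
          also have "\<dots> \<le> c k" using elim(2) x by blast
          finally show "(\<integral>\<^sup>+ y. f (x, y) * ennreal (indicator (B (i + K) \<times> B (i + K)) (x, y) * \<psi> (i + K) (x, y)) \<partial>lborel) \<le> c k" .
        qed (use f_fin in measurable)
      qed
    qed
  qed
  moreover have "AE y in lborel. y \<notin> D' k \<longrightarrow> (\<integral>\<^sup>+ x. f (x, y) * ennreal (1 - \<theta> (x, y)) \<partial>lborel) \<le> d k" for k
  proof -
    define K where "K = nat \<bar>k\<bar>"
    have "AE y in lborel. \<forall>i. y \<notin> D' k \<longrightarrow> (\<integral>\<^sup>+ x. g (i + K) (x, y) * ennreal (1 - \<psi> (i + K) (x, y)) \<partial>lborel) \<le> d k"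
    proof (subst AE_all_countable, rule allI)
      fix i
      have "\<bar>k\<bar> \<le> int (i + K)" by (simp add: K_def)
      then show "AE y in lborel. y \<notin> D' k \<longrightarrow> (\<integral>\<^sup>+ x. g (i + K) (x, y) * ennreal (1 - \<psi> (i + K) (x, y)) \<partial>lborel) \<le> d k"
        using \<psi>[of "i + K"] by (simp add: A_def col_ok_def)
    qed
    with tend' show ?thesis
    proof eventually_elim
      case (elim y)
      show ?case
      proof
        assume y: "y \<notin> D' k"
        show "(\<integral>\<^sup>+ x. f (x, y) * ennreal (1 - \<theta> (x, y)) \<partial>lborel) \<le> d k"
        proof (rule nn_integral_Fatou_le[where u = "\<lambda>i x. indicator (B (i + K) \<times> B (i + K)) (x, y) * (1 - \<psi> (i + K) (x, y))"])
          show "AE x in lborel. (\<lambda>i. indicator (B (i + K) \<times> B (i + K)) (x, y) * (1 - \<psi> (i + K) (x, y))) \<longlonglongrightarrow> 1 - \<theta> (x, y)"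
            using elim(1) by eventually_elim (rule box_tend, intro tendsto_intros)
          fix i
          have "(\<integral>\<^sup>+ x. f (x, y) * ennreal (indicator (B (i + K) \<times> B (i + K)) (x, y) * (1 - \<psi> (i + K) (x, y))) \<partial>lborel)
              = (\<integral>\<^sup>+ x. g (i + K) (x, y) * ennreal (1 - \<psi> (i + K) (x, y)) \<partial>lborel)"
            by (intro nn_integral_cong) (auto simp: g_def split: split_indicator)
          also have "\<dots> \<le> d k" using elim(2) y by blast
          finally show "(\<integral>\<^sup>+ x. f (x, y) * ennreal (indicator (B (i + K) \<times> B (i + K)) (x, y) * (1 - \<psi> (i + K) (x, y))) \<partial>lborel) \<le> d k" .
        qed (use f_fin in measurable)
      qed
    qed
  qed
  moreover have "0 \<le> \<theta> z \<and> \<theta> z \<le> 1" for z by (simp add: \<theta>_def)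
  ultimately show thesis using \<open>\<theta> \<in> borel_measurable plane\<close> by (intro that[of \<theta>]) auto
qed

text \<open>For given s take k with \<sigma> \<rho>^k \<le> s < \<sigma> \<rho>^(k+1). The bound at
  level k controls g*(s), and comparing s with the next level costs the factor \<rho>^(1/p).\<close>

lemma weakLp_norm_le_levels:
  fixes r :: "real \<Rightarrow> ennreal" and D :: "int \<Rightarrow> real set"
  assumes q: "0 < q" and p: "0 \<le> pinv p" and \<rho>: "1 < \<rho>" and \<sigma>: "0 < \<sigma>" and B: "0 < B"
    and D: "\<And>k. D k \<in> sets lborel" "\<And>k. emeasure lborel (D k) \<le> ennreal (\<sigma> * \<rho> powr real_of_int k)"
    and r: "\<And>k. AE x in lborel. x \<notin> D k \<longrightarrow>
      r x \<le> ennreal ((B * (\<sigma> * \<rho> powr real_of_int k) powr - pinv p) powr q)"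
  shows "weakLp_norm p (\<lambda>x. enn_powr (r x) (1 / q)) \<le> ennreal (B * \<rho> powr pinv p)"
  unfolding weakLp_norm_def
proof (rule SUP_least)
  fix s :: real assume "s \<in> {0<..}"
  then have s: "0 < s" by simp
  define k where "k = \<lfloor>log \<rho> (s / \<sigma>)\<rfloor>"
  have "real_of_int k \<le> log \<rho> (s / \<sigma>)" "log \<rho> (s / \<sigma>) < real_of_int k + 1"
    unfolding k_def by linarith+
  then have "\<rho> powr real_of_int k \<le> s / \<sigma>" "s / \<sigma> < \<rho> powr (real_of_int k + 1)"
    using \<rho> s \<sigma> by (simp_all add: le_log_iff log_less_iff)
  then have k: "\<sigma> * \<rho> powr real_of_int k \<le> s" "s < \<sigma> * \<rho> powr real_of_int k * \<rho>"
    using \<sigma> \<rho> by (simp_all add: field_simps powr_add)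
  define w where "w = \<sigma> * \<rho> powr real_of_int k"
  define \<mu> where "\<mu> = B * w powr - pinv p"
  have w: "0 < w" using \<sigma> \<rho> by (simp add: w_def)
  have \<mu>: "0 < \<mu>" using B w by (simp add: \<mu>_def)
  have "AE x in lborel. x \<in> {x. ennreal \<mu> < enn_powr (r x) (1 / q)} \<longrightarrow> x \<in> D k"
    using r[of k]
  proof eventually_elim
    case (elim x)
    then show ?case using enn_powr_less_iff[of \<mu> q "r x"] \<mu> q by (auto simp: \<mu>_def w_def not_less[symmetric])
  qed
  then have "emeasure lborel {x. ennreal \<mu> < enn_powr (r x) (1 / q)} \<le> emeasure lborel (D k)"
    using D by (intro emeasure_mono_AE) auto
  also have "\<dots> \<le> ennreal s" using D(2)[of k] k(1) by (meson ennreal_leI order_trans)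
  finally have "drearr (\<lambda>x. enn_powr (r x) (1 / q)) s \<le> ennreal \<mu>"
    unfolding drearr_def using \<mu> by (intro Inf_lower) auto
  then have "ennreal (s powr pinv p) * drearr (\<lambda>x. enn_powr (r x) (1 / q)) s
      \<le> ennreal (s powr pinv p) * ennreal \<mu>" by (rule mult_left_mono) simp
  also have "\<dots> = ennreal (s powr pinv p * \<mu>)" using \<mu> by (simp add: ennreal_mult)
  also have "s powr pinv p * \<mu> \<le> (w * \<rho>) powr pinv p * \<mu>"
    using k s p \<mu> by (intro mult_right_mono powr_mono2) (auto simp: w_def)
  also have "\<dots> = B * \<rho> powr pinv p"
    using w \<rho> by (simp add: \<mu>_def powr_mult powr_minus field_simps)
  finally show "ennreal (s powr pinv p) * drearr (\<lambda>x. enn_powr (r x) (1 / q)) s \<le> ennreal (B * \<rho> powr pinv p)"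
    by (simp add: ennreal_leI)
qed

text \<open>The q-th power of the bound on a rectangle: as (1/q - 1/p) q = \<beta>, the weight
  t^(-1) becomes division of |F| by t^(q/\<beta>). Rectangles with a null side, over which the
  supremum does not range, have mass 0.\<close>

lemma triple_norm_rectangle:
  assumes q: "1 \<le> q" and p: "ereal q < p" and t: "t > 0"
    and N: "triple_norm p q t a \<le> ennreal N" "0 \<le> N"
    and [measurable]: "a \<in> borel_measurable plane"
    and EF[measurable]: "E \<in> sets lborel" "F \<in> sets lborel"
    and fin: "emeasure lborel E < \<infinity>" "emeasure lborel F < \<infinity>"
  defines "\<beta> \<equiv> 1 - q * pinv p"
  shows "(\<integral>\<^sup>+ z. ennreal (\<bar>a z\<bar> powr q) * indicator (E \<times> F) z \<partial>plane)
    \<le> ennreal (N powr q * max (measure lborel E) (measure lborel F / t powr (q / \<beta>)) powr \<beta>)"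
proof (cases "emeasure lborel E = 0 \<or> emeasure lborel F = 0")
  case True
  have "emeasure plane (E \<times> F) = emeasure lborel E * emeasure lborel F"
    by (rule lborel.emeasure_pair_measure_Times) measurable
  with True have "emeasure plane (E \<times> F) = 0" by auto
  then have null: "E \<times> F \<in> null_sets plane" by (rule null_setsI) measurable
  have "(\<integral>\<^sup>+ z. ennreal (\<bar>a z\<bar> powr q) * indicator (E \<times> F) z \<partial>plane) = 0"
    by (rule nn_integral_null_set[OF null])
  then show ?thesis by simp
next
  case False
  define \<alpha> where "\<alpha> = 1 / q - pinv p"
  note \<pi> = pinv_bounds[OF q p]
  have \<beta>: "0 < \<beta>" using \<pi> by (simp add: \<beta>_def)
  have \<alpha>q: "\<alpha> * q = \<beta>" using q by (simp add: \<alpha>_def \<beta>_def algebra_simps)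
  let ?I = "\<integral>\<^sup>+ z. ennreal (\<bar>a z\<bar> powr q) * indicator (E \<times> F) z \<partial>plane"
  define m where "m = measure lborel E"
  define m' where "m' = measure lborel F"
  have m: "0 < m" "0 < m'"
    using False fin by (auto simp: m_def m'_def emeasure_eq_ennreal_measure zero_less_measure_iff)
  define M where "M = max (m powr \<alpha>) ((1 / t) * m' powr \<alpha>)"
  have M: "0 < M" using m by (simp add: M_def less_max_iff_disj)
  have "ennreal (1 / M) * enn_powr ?I (1 / q) \<le> triple_norm p q t a"
    unfolding triple_norm_def M_def m_def m'_def \<alpha>_def
    using False EF fin by (intro SUP_upper2[of "(E, F)"]) (auto simp: zero_less_iff_neq_zero)
  with N have "ennreal (1 / M) * enn_powr ?I (1 / q) \<le> ennreal N" by simp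
  then have "ennreal M * (ennreal (1 / M) * enn_powr ?I (1 / q)) \<le> ennreal M * ennreal N"
    by (rule mult_left_mono) simp
  moreover have "ennreal M * ennreal (1 / M) = 1"
    using M by (simp add: ennreal_mult[symmetric])
  moreover have "ennreal M * ennreal N = ennreal (N * M)"
    using M N by (simp add: ennreal_mult[symmetric] mult.commute)
  ultimately have "enn_powr ?I (1 / q) \<le> ennreal (N * M)"
    unfolding mult.assoc[symmetric] by simp
  then have "?I \<le> ennreal ((N * M) powr q)"
    using M N q by (subst (asm) enn_powr_le_iff) auto
  also have "(N * M) powr q \<le> N powr q * max m (m' / t powr (q / \<beta>)) powr \<beta>"
  proof -
    have "(m powr \<alpha>) powr q = m powr \<beta>" by (simp add: powr_powr \<alpha>q)
    moreover have "((1 / t) * m' powr \<alpha>) powr q = (m' / t powr (q / \<beta>)) powr \<beta>"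
      using t m \<beta> by (simp add: powr_powr powr_divide powr_mult \<alpha>q)
    moreover have "m powr \<beta> \<le> max m (m' / t powr (q / \<beta>)) powr \<beta>"
      "(m' / t powr (q / \<beta>)) powr \<beta> \<le> max m (m' / t powr (q / \<beta>)) powr \<beta>"
      using m \<beta> by (auto intro!: powr_mono2)
    ultimately have "M powr q \<le> max m (m' / t powr (q / \<beta>)) powr \<beta>"
      unfolding M_def max_def by (auto split: if_splits)
    then show ?thesis using N M by (simp add: powr_mult mult_left_mono)
  qed
  finally show ?thesis by (simp add: m_def m'_def ennreal_leI)
qed

text \<open>The fractional assignment yields parts of norm at most M in A_0 and M/t in A_1, and the
  two equal contributions to K give the factor 2. The gap between N and M is spent on the strict
  inequality for the cores and on the ratio of the levels.\<close>

lemma Kfun_le_of_triple_norm_less: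
  assumes q: "1 \<le> q" and p: "ereal q < p" and t: "t > 0"
    and a[measurable]: "a \<in> borel_measurable plane"
    and N: "triple_norm p q t a = ennreal N" "0 \<le> N" and M: "N < M"
  shows "Kfun p q t a \<le> ennreal (2 * M)"
proof -
  note \<pi> = pinv_bounds[OF q p]
  define \<beta> where "\<beta> = 1 - q * pinv p"
  have \<beta>: "0 < \<beta>" "\<beta> \<le> 1" using \<pi> q by (auto simp: \<beta>_def)
  define \<kappa> where "\<kappa> = t powr (q / \<beta>)"
  have \<kappa>: "0 < \<kappa>" using t by (simp add: \<kappa>_def)
  \<comment> \<open>N < N1 makes the cores small; \<rho> = M/N1 absorbs the discretisation loss,
    since \<rho>^(1/p) \<le> \<rho>.\<close>
  define N1 where "N1 = (N + M) / 2"
  have N1: "N < N1" "0 < N1" "N1 < M" using N M by (auto simp: N1_def)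
  define \<rho> where "\<rho> = M / N1"
  have \<rho>: "1 < \<rho>" using N1 by (simp add: \<rho>_def)
  have \<rho>_le: "N1 * \<rho> powr pinv p \<le> M"
  proof -
    have "1 * pinv p \<le> q * pinv p" using q \<pi> by (intro mult_right_mono) auto
    then have "pinv p \<le> 1" using \<pi> by simp
    then have "\<rho> powr pinv p \<le> \<rho> powr 1" using \<rho> by (intro powr_mono) auto
    then have "N1 * \<rho> powr pinv p \<le> N1 * \<rho>" using N1 \<rho> by (intro mult_left_mono) auto
    then show ?thesis using N1 by (simp add: \<rho>_def)
  qed
  define A1 where "A1 = N1 powr q"
  have A1: "0 < A1" "N powr q < A1"
    using N N1 q by (auto simp: A1_def intro!: powr_less_mono2)
  define s where "s k = \<rho> powr real_of_int k" for k :: int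
  have s: "0 < s k" for k using \<rho> by (simp add: s_def)
  have s_mono: "k \<le> l \<Longrightarrow> s k \<le> s l" for k l using \<rho> by (auto simp: s_def intro!: powr_mono)
  define f where "f z = ennreal (\<bar>a z\<bar> powr q)" for z
  have f[measurable]: "f \<in> borel_measurable plane" unfolding f_def by measurable
  define c where "c k = ennreal (A1 * s k powr (\<beta> - 1))" for k
  define d where "d k = ennreal (A1 * s k powr (\<beta> - 1) / \<kappa>)" for k
  have powr_anti: "s l powr (\<beta> - 1) \<le> s k powr (\<beta> - 1)" if "k \<le> l" for k l
    using s s_mono[OF that] \<beta> by (intro powr_mono2') auto
  have "antimono c" "antimono d"
    using powr_anti A1 \<kappa> unfolding c_def d_def
    by (auto intro!: antimonoI ennreal_leI mult_left_mono divide_right_mono)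
  define Bx where "Bx n = {- real n..real n}" for n :: nat
  define D where "D k = (\<Union>n. core_row f (c k) (d k) (Bx n) (Bx n))" for k
  define D' where "D' k = (\<Union>n. core_col f (c k) (d k) (Bx n) (Bx n))" for k
  obtain \<theta> where \<theta>[measurable]: "\<theta> \<in> borel_measurable plane" and \<theta>_bd: "\<And>z. 0 \<le> \<theta> z \<and> \<theta> z \<le> 1"
    and row: "\<And>k. AE x in lborel. x \<notin> D k \<longrightarrow> (\<integral>\<^sup>+ y. f (x, y) * ennreal (\<theta> (x, y)) \<partial>lborel) \<le> c k"
    and col: "\<And>k. AE y in lborel. y \<notin> D' k \<longrightarrow> (\<integral>\<^sup>+ x. f (x, y) * ennreal (1 - \<theta> (x, y)) \<partial>lborel) \<le> d k"
    by (rule fractional_assignment[OF f _ \<open>antimono c\<close> \<open>antimono d\<close>, folded Bx_def, folded D_def D'_def])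
       (simp add: f_def, rule that)
  have Bx: "Bx n \<in> sets lborel" "emeasure lborel (Bx n) < \<infinity>" for n by (auto simp: Bx_def)
  have rect: "(\<integral>\<^sup>+ z. f z * indicator (E \<times> F) z \<partial>plane)
      \<le> ennreal (N powr q * max (measure lborel E) (measure lborel F / \<kappa>) powr \<beta>)"
    if "E \<in> sets lborel" "F \<in> sets lborel" "emeasure lborel E < \<infinity>" "emeasure lborel F < \<infinity>" for E F
    unfolding f_def \<kappa>_def \<beta>_def using triple_norm_rectangle[OF q p t _ N(2) a that] N(1) by simp
  note core = core_measure_le[OF f Bx(1) Bx(1) Bx(2) Bx(2) powr_ge_zero A1(2) \<beta>(2) \<kappa> s rect c_def d_def]
  have row_core: "emeasure lborel (core_row f (c k) (d k) (Bx n) (Bx n)) \<le> ennreal (s k)" for k n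
    by (rule core(1))
  have col_core: "emeasure lborel (core_col f (c k) (d k) (Bx n) (Bx n)) \<le> ennreal (\<kappa> * s k)" for k n
    by (rule core(2))
  have inc: "incseq (\<lambda>n. core_row f (c k) (d k) (Bx n) (Bx n))"
    "incseq (\<lambda>n. core_col f (c k) (d k) (Bx n) (Bx n))" for k
    by (intro incseq_SucI core_mono; simp add: Bx_def)+
  have rng: "range (\<lambda>n. core_row f (c k) (d k) (Bx n) (Bx n)) \<subseteq> sets lborel"
    "range (\<lambda>n. core_col f (c k) (d k) (Bx n) (Bx n)) \<subseteq> sets lborel" for k
    using core_sets[OF f Bx(1) Bx(1)] by auto
  have D_sets: "D k \<in> sets lborel" "D' k \<in> sets lborel" for k
    using rng[of k] unfolding D_def D'_def by (auto simp del: sets_lborel)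
  have D_le: "emeasure lborel (D k) \<le> ennreal (1 * \<rho> powr real_of_int k)" for k
    unfolding D_def SUP_emeasure_incseq[OF rng(1) inc(1), symmetric]
    using row_core by (intro SUP_least) (simp add: s_def)
  have D'_le: "emeasure lborel (D' k) \<le> ennreal (\<kappa> * \<rho> powr real_of_int k)" for k
    unfolding D'_def SUP_emeasure_incseq[OF rng(2) inc(2), symmetric]
    using col_core by (intro SUP_least) (simp add: s_def)
  define b where "b z = \<theta> z * a z" for z
  define b' where "b' z = (1 - \<theta> z) * a z" for z
  have [measurable]: "b \<in> borel_measurable plane" "b' \<in> borel_measurable plane"
    unfolding b_def[abs_def] b'_def[abs_def] by measurable
  \<comment> \<open>For u in [0, 1] and q \<ge> 1 one has u^q \<le> u, so multiplying a by u
    multiplies f by at most u.\<close>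
  have scale: "ennreal (\<bar>u * a z\<bar> powr q) \<le> f z * ennreal u" if u: "0 \<le> u" "u \<le> 1" for u z
  proof -
    have "u powr q \<le> u"
    proof (cases "u = 0")
      case False
      then have "u powr q \<le> u powr 1" using u q by (intro powr_mono') auto
      then show ?thesis using u False by simp
    qed simp
    then have "\<bar>u * a z\<bar> powr q \<le> \<bar>a z\<bar> powr q * u"
      using u by (simp add: abs_mult powr_mult mult.commute mult_right_mono)
    then show ?thesis using u by (simp add: f_def ennreal_mult[symmetric] ennreal_leI)
  qed
  have level_powr: "(n * w powr - pinv p) powr q = n powr q * w powr (\<beta> - 1)" if "0 \<le> n" for n w
  proof -
    have "- pinv p * q = \<beta> - 1" by (simp add: \<beta>_def)
    then show ?thesis using that by (simp add: powr_mult powr_powr)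
  qed
  have norm_b: "normA0 p q b \<le> ennreal M"
  proof -
    have "weakLp_norm p (\<lambda>x. enn_powr (\<integral>\<^sup>+ y. ennreal (\<bar>b (x, y)\<bar> powr q) \<partial>lborel) (1 / q))
        \<le> ennreal (N1 * \<rho> powr pinv p)"
    proof (rule weakLp_norm_le_levels[OF _ \<pi>(1) \<rho> zero_less_one N1(2) D_sets(1) D_le])
      fix k
      have ck: "c k = ennreal ((N1 * (1 * \<rho> powr real_of_int k) powr - pinv p) powr q)"
        using N1 by (simp add: level_powr c_def A1_def s_def)
      show "AE x in lborel. x \<notin> D k \<longrightarrow> (\<integral>\<^sup>+ y. ennreal (\<bar>b (x, y)\<bar> powr q) \<partial>lborel)
          \<le> ennreal ((N1 * (1 * \<rho> powr real_of_int k) powr - pinv p) powr q)"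
        using row[of k]
      proof eventually_elim
        case (elim x)
        have "(\<integral>\<^sup>+ y. ennreal (\<bar>b (x, y)\<bar> powr q) \<partial>lborel) \<le> (\<integral>\<^sup>+ y. f (x, y) * ennreal (\<theta> (x, y)) \<partial>lborel)"
          unfolding b_def using \<theta>_bd by (intro nn_integral_mono scale) auto
        with elim show ?case unfolding ck by (blast intro: order_trans)
      qed
    qed (use q in simp)
    also have "\<dots> \<le> ennreal M" using \<rho>_le by (rule ennreal_leI)
    finally show ?thesis by (simp add: normA0_def slice_norm_x_def[abs_def])
  qed
  have norm_b': "normA1 p q b' \<le> ennreal (M / t)"
  proof -
    have "weakLp_norm p (\<lambda>y. enn_powr (\<integral>\<^sup>+ x. ennreal (\<bar>b' (x, y)\<bar> powr q) \<partial>lborel) (1 / q))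
        \<le> ennreal (N1 / t * \<rho> powr pinv p)"
    proof (rule weakLp_norm_le_levels[OF _ \<pi>(1) \<rho> \<kappa> _ D_sets(2) D'_le])
      fix k
      \<comment> \<open>This identity rewrites the column threshold as the q-th power of (N1/t)
        (\<kappa> s)^(-1/p), the level bound with constant N1/t at scale \<kappa>.\<close>
      have "\<kappa> powr (\<beta> - 1) = t powr q / \<kappa>"
        using \<beta> t by (simp add: \<kappa>_def powr_powr powr_diff)
      then have dk: "d k = ennreal ((N1 / t * (\<kappa> * \<rho> powr real_of_int k) powr - pinv p) powr q)"
        using N1 \<kappa> t s[of k] level_powr[of "N1 / t" "\<kappa> * s k"]
        by (simp add: d_def A1_def s_def[symmetric] powr_mult[of \<kappa>] powr_divide)
      show "AE y in lborel. y \<notin> D' k \<longrightarrow> (\<integral>\<^sup>+ x. ennreal (\<bar>b' (x, y)\<bar> powr q) \<partial>lborel)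
          \<le> ennreal ((N1 / t * (\<kappa> * \<rho> powr real_of_int k) powr - pinv p) powr q)"
        using col[of k]
      proof eventually_elim
        case (elim y)
        have "(\<integral>\<^sup>+ x. ennreal (\<bar>b' (x, y)\<bar> powr q) \<partial>lborel) \<le> (\<integral>\<^sup>+ x. f (x, y) * ennreal (1 - \<theta> (x, y)) \<partial>lborel)"
          unfolding b'_def using \<theta>_bd by (intro nn_integral_mono scale) auto
        with elim show ?case unfolding dk by (blast intro: order_trans)
      qed
    qed (use q N1 t in auto)
    also have "\<dots> \<le> ennreal (M / t)" using \<rho>_le t by (intro ennreal_leI) (simp add: divide_right_mono)
    finally show ?thesis by (simp add: normA1_def slice_norm_y_def[abs_def])
  qed
  have "b \<in> spaceA0 p q" "b' \<in> spaceA1 p q"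
    using norm_b norm_b' by (auto simp: spaceA0_def spaceA1_def intro: order.strict_trans1)
  moreover have "a = (\<lambda>z. b z + b' z)" by (simp add: fun_eq_iff b_def b'_def algebra_simps)
  ultimately have "Kfun p q t a \<le> normA0 p q b + ennreal t * normA1 p q b'"
    unfolding Kfun_def by (intro Inf_lower) blast
  also have "\<dots> \<le> ennreal M + ennreal t * ennreal (M / t)"
    using norm_b norm_b' by (intro add_mono mult_left_mono) auto
  also have "\<dots> = ennreal (2 * M)"
    using t N1 by (simp add: ennreal_mult[symmetric] ennreal_plus[symmetric] del: ennreal_plus)
  finally show ?thesis .
qed

lemma Kfun_le_triple_norm:
  assumes "1 \<le> q" "ereal q < p" "t > 0" "a \<in> borel_measurable plane"
  shows "Kfun p q t a \<le> 2 * triple_norm p q t a"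
proof (cases "triple_norm p q t a")
  case (real N)
  have "Kfun p q t a \<le> 2 * triple_norm p q t a + ennreal e" if e: "0 < e" for e
  proof -
    have "Kfun p q t a \<le> ennreal (2 * (N + e / 2))"
      using real e by (intro Kfun_le_of_triple_norm_less[OF assms]) auto
    also have "\<dots> = 2 * triple_norm p q t a + ennreal e"
      using real e by (simp add: ennreal_mult)
    finally show ?thesis .
  qed
  then show ?thesis by (rule ennreal_le_epsilon)
qed simp

theorem theorem3p1:
  fixes p :: ereal and q t :: real and a :: "real \<times> real \<Rightarrow> real"
  assumes "1 \<le> q" and "ereal q < p"
    and "t > 0"
    and "a \<in> sumA p q"
  shows "ennreal ((1 - q * pinv p) powr (1 / q)) * triple_norm p q t a \<le> Kfun p q t a
       \<and> Kfun p q t a \<le> 2 * triple_norm p q t a"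
proof
  show "ennreal ((1 - q * pinv p) powr (1 / q)) * triple_norm p q t a \<le> Kfun p q t a"
    using assms(1-3) by (rule triple_norm_le_Kfun)
  have "a \<in> borel_measurable plane"
    using assms(4) by (auto simp: sumA_def spaceA0_def spaceA1_def)
  with assms(1-3) show "Kfun p q t a \<le> 2 * triple_norm p q t a" by (rule Kfun_le_triple_norm)
qed

end
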